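(* Suppose that the following two assumptions hold. (A1) The orbit partition $\pi_{\mathcal G}$ of the hidden subgroup $\mathcal G$ belongs to a known class $\mathcal Q_{d,\le d_0}\subset\mathcal P_{d,\le d_0}$ of partitions of $[d]$ with at most $d_0$ classes, and there are constants $c,C_0>0$ with $|\mathcal Q_{d,k}|\le C_0 d^{ck}$ for every $k\in[d_0]$. (A2) There are $K_x,R_{\max}>0$ such that for all $x\in\mathcal X$ and all $m\in\overline{\mathcal M}$, $\|\Pi_m(x)\|_2^2\le K_x$ and $|\langle x,\theta_\star\rangle|\le R_{\max}$. Run the algorithm Explore-Models-then-Commit (defined in the context) with exploration length $$t_1=R_{\max}^{-2/3}\,\sigma^{2/3}\,C_{\min}^{-1/3}(\mathcal X)\,K_x^{1/3}\,d_0^{1/3}\,T^{2/3}\,(\log(dT))^{1/3}$$ (rounded up to an integer). Then its expected regret satisfies $$\mathbf R_T=O\Big(R_{\max}^{1/3}\,\sigma^{2/3}\,C_{\min}^{-1/3}(\mathcal X)\,K_x^{1/3}\,d_0^{1/3}\,T^{2/3}\,(\log(dT))^{1/3}\Big).$$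
   Context: Asymptotic convention: the $O(\cdot)$ bound is as $T\to\infty$, i.e. it holds for all $T$ larger than a threshold that may depend on the other parameters, with a hidden constant depending only on $c$ and $C_0$. Bandit model: in each round $t=1,\dots,T$ ($T$ known) the learner picks $x_t\in\mathcal X\subset\mathbb R^d$ ($d\ge2$) and observes $y_t=\langle x_t,\theta_\star\rangle+\eta_t$, with $\eta_t$ i.i.d. $N(0,\sigma^2)$, $\sigma>0$. $\mathbf R_T=\mathbb E[\sum_{t=1}^T\langle x_\star-x_t,\theta_\star\rangle]$, $x_\star\in\arg\max_{x\in\mathcal X}\langle x,\theta_\star\rangle$. All maxima over $\mathcal X$ are assumed attained (e.g. $\mathcal X$ compact). Symmetry: $\mathcal S_d$ (bijections of $[d]$) acts on $\mathbb R^d$ by $g\cdot x=(x_{g(i)})_{i\in[d]}$. An unknown subgroup $\mathcal G\le\mathcal S_d$ satisfies $g\cdot\theta_\star=\theta_\star$ for all $g\in\mathcal G$. $\pi_{\mathcal G}$ is the partition of $[d]$ into $\mathcal G$-orbits. $\mathcal P_{d,\le d_0}$ is the set of partitions of $[d]$ with at most $d_0$ classes; $\mathcal Q_{d,k}$ is the set of members of $\mathcal Q_{d,\le d_0}$ with exactly $k$ classes. Models: a partition $p$ of $[d]$ corresponds to the subspace $m_p=\{\theta\in\mathbb R^d\mid \theta_i=\theta_j \text{ whenever } i,j \text{ are in the same class of } p\}$ (the fixed-point subspace of any subgroup with orbit partition $p$). $\mathcal M=\{m_p\mid p\in\mathcal Q_{d,\le d_0}\}$ and $\overline{\mathcal M}=\{\mathrm{conv}(m\cup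 m')\mid m,m'\in\mathcal M\}$, where $\mathrm{conv}(m\cup m')=m+m'$ is a subspace. $\Pi_S$ denotes Euclidean projection onto $S$. Exploratory distribution: $\nu\in\arg\max_{\omega}\lambda_{\min}(\mathbb E_{x\sim\omega}[xx^\top])$ over probability measures $\omega$ on $\mathcal X$; $C_{\min}(\mathcal X)=\lambda_{\min}(\mathbb E_{x\sim\nu}[xx^\top])$, assumed positive. Algorithm Explore-Models-then-Commit (input $T,\nu,t_1$): in rounds $t=1,\dots,t_1$ draw $x_t$ i.i.d. from $\nu$ and observe $y_t$. Put $X=[x_1,\dots,x_{t_1}]^\top$, $Y=(y_1,\dots,y_{t_1})^\top$. For $m\in\mathcal M$ let $S_m=\{X\theta\mid\theta\in m\}$ (the column space of the matrix with rows $\Pi_m(x_t)^\top$). Choose $\widehat m\in\arg\min_{m\in\mathcal M}\|Y-\Pi_{S_m}(Y)\|_2^2$ and $\widehat\theta_{t_1}\in\arg\min_{\theta\in\widehat m}\|Y-X\theta\|_2^2$. In rounds $t=t_1+1,\dots,T$ play $x_t\in\arg\max_{x\in\mathcal X}\langle\widehat\theta_{t_1},x\rangle$. *)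

theory Defs
  imports
    "HOL-Probability.Probability"
    "HOL-Algebra.Sym_Groups"
    "HOL-Algebra.Group_Action"
    "Jordan_Normal_Form.Spectral_Radius"
begin

text \<open>
  The hidden constant of the regret bound must not depend on the dimension, so the dimension has to be
  quantified inside the statement. Vectors of length \<open>n\<close> are therefore functions on \<open>{1..n}\<close>
  (\<open>undefined\<close> outside), and the Borel sigma-algebra is the product one.
  The index set \<open>{1..d}\<close> is the one on which \<^const>\<open>sym_group\<close> acts.
\<close>

type_synonym rvec = "nat \<Rightarrow> real"

definition vecs :: "nat \<Rightarrow> rvec set" where
  "vecs n = {1..n} \<rightarrow>\<^sub>E UNIV"

definition borel_vec :: "nat \<Rightarrow> rvec measure" where
  "borel_vec n = Pi\<^sub>M {1..n} (\<lambda>_. borel)"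

definition dot :: "nat \<Rightarrow> rvec \<Rightarrow> rvec \<Rightarrow> real" where
  "dot n x y = (\<Sum>i = 1..n. x i * y i)"

definition vnorm :: "nat \<Rightarrow> rvec \<Rightarrow> real" where
  "vnorm n x = L2_set x {1..n}"

text \<open>Only applied to linear subspaces of \<open>vecs n\<close>, where the nearest point exists and is unique.\<close>

definition proj :: "nat \<Rightarrow> rvec set \<Rightarrow> rvec \<Rightarrow> rvec" where
  "proj n S v = arg_min (\<lambda>w. vnorm n (\<lambda>i. v i - w i)) (\<lambda>w. w \<in> S)"

definition convex_vec :: "nat \<Rightarrow> rvec set \<Rightarrow> bool" where
  "convex_vec n S \<longleftrightarrow>
     (\<forall>x\<in>S. \<forall>y\<in>S. \<forall>u\<ge>0. \<forall>v\<ge>0. u + v = 1 \<longrightarrow> (\<lambda>i\<in>{1..n}. u * x i + v * y i) \<in> S)"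

definition perm_act :: "nat \<Rightarrow> (nat \<Rightarrow> nat) \<Rightarrow> rvec \<Rightarrow> rvec" where
  "perm_act d g x = (\<lambda>i\<in>{1..d}. x (g i))"

definition orbit_partition :: "nat \<Rightarrow> (nat \<Rightarrow> nat) set \<Rightarrow> nat set set" where
  "orbit_partition d G = orbits (sym_group d\<lparr>carrier := G\<rparr>) {1..d} (\<lambda>g. g)"

definition partitions_upto :: "nat \<Rightarrow> nat \<Rightarrow> nat set set set" where
  "partitions_upto d d0 = {p. partition_on {1..d} p \<and> card p \<le> d0}"

definition fixed_space :: "nat \<Rightarrow> nat set set \<Rightarrow> rvec set" where
  "fixed_space d p = {\<theta> \<in> vecs d. \<forall>B\<in>p. \<forall>i\<in>B. \<forall>j\<in>B. \<theta> i = \<theta> j}"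

definition models :: "nat \<Rightarrow> nat set set set \<Rightarrow> rvec set set" where
  "models d Q = fixed_space d ` Q"

definition joined_models :: "nat \<Rightarrow> nat set set set \<Rightarrow> rvec set set" where
  "joined_models d Q = {convex_vec d hull (m \<union> m') | m m'. m \<in> models d Q \<and> m' \<in> models d Q}"

text \<open>
  Exploratory distribution. Probability measures on \<open>X\<close> live on the trace of the Borel
  sigma-algebra, so \<open>X\<close> itself need not be a Borel set. The rows and columns of matrices in
  \<^theory>\<open>Jordan_Normal_Form.Matrix\<close> are numbered from 0, hence the index shift.
  \<open>lambda_min\<close> is only applied to real symmetric matrices of positive dimension,
  whose spectrum is finite and nonempty.
\<close>

definition arm_space :: "nat \<Rightarrow> rvec set \<Rightarrow> rvec measure" where
  "arm_space d X = restrict_space (borel_vec d) X"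

definition arm_dists :: "nat \<Rightarrow> rvec set \<Rightarrow> rvec measure set" where
  "arm_dists d X = {\<omega>. prob_space \<omega> \<and> sets \<omega> = sets (arm_space d X)}"

definition second_moment :: "nat \<Rightarrow> rvec measure \<Rightarrow> real mat" where
  "second_moment d \<omega> = mat d d (\<lambda>(i, j). \<integral>x. x (Suc i) * x (Suc j) \<partial>\<omega>)"

definition lambda_min :: "real mat \<Rightarrow> real" where
  "lambda_min A = Min (spectrum A)"

definition exploratory :: "nat \<Rightarrow> rvec set \<Rightarrow> rvec measure \<Rightarrow> bool" where
  "exploratory d X \<nu> \<longleftrightarrow>
     is_arg_max (\<lambda>\<omega>. lambda_min (second_moment d \<omega>)) (\<lambda>\<omega>. \<omega> \<in> arm_dists d X) \<nu>"

text \<open>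
  Explore-Models-then-Commit. A sample point \<open>(x, \<eta>, u)\<close> consists of the exploratory arms
  \<open>x 1, \<dots>, x n\<close> (i.i.d. from \<open>\<nu>\<close>), the noise \<open>\<eta> 1, \<dots>, \<eta> T\<close> (i.i.d. centred
  normal with standard deviation \<open>\<sigma>\<close>), and an independent seed \<open>u\<close> with arbitrary law \<open>U\<close>
  that the learner may use to break ties.
\<close>

type_synonym sample = "(nat \<Rightarrow> rvec) \<times> rvec \<times> real"

definition sample_space ::
    "rvec measure \<Rightarrow> real \<Rightarrow> nat \<Rightarrow> nat \<Rightarrow> real measure \<Rightarrow> sample measure" where
  "sample_space \<nu> \<sigma> n T U =
     Pi\<^sub>M {1..n} (\<lambda>_. \<nu>) \<Otimes>\<^sub>M
       (Pi\<^sub>M {1..T} (\<lambda>_. density lborel (\<lambda>z. ennreal (normal_density 0 \<sigma> z))) \<Otimes>\<^sub>M U)"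

text \<open>The vector \<open>X \<theta>\<close>, for the design matrix \<open>X\<close> with rows \<open>x 1, \<dots>, x n\<close>\<close>

definition design :: "nat \<Rightarrow> nat \<Rightarrow> (nat \<Rightarrow> rvec) \<Rightarrow> rvec \<Rightarrow> rvec" where
  "design d n x \<theta> = (\<lambda>t\<in>{1..n}. dot d (x t) \<theta>)"

definition rewards :: "nat \<Rightarrow> nat \<Rightarrow> rvec \<Rightarrow> (nat \<Rightarrow> rvec) \<Rightarrow> rvec \<Rightarrow> rvec" where
  "rewards d n \<theta>\<^sub>s x \<eta> = (\<lambda>t\<in>{1..n}. dot d (x t) \<theta>\<^sub>s + \<eta> t)"

text \<open>
  \<open>mh\<close>, \<open>th\<close> and \<open>play t\<close> are the random selected model, the random estimate and the random arm
  of the commit round \<open>t\<close>. They are arbitrary measurable selections from the respective argmin and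
  argmax sets; measurability keeps the expectation in \<open>regret\<close> meaningful.
\<close>

definition emc_run ::
    "nat \<Rightarrow> rvec set \<Rightarrow> nat set set set \<Rightarrow> rvec \<Rightarrow> nat \<Rightarrow> nat \<Rightarrow> sample measure \<Rightarrow>
     (sample \<Rightarrow> rvec set) \<Rightarrow> (sample \<Rightarrow> rvec) \<Rightarrow> (nat \<Rightarrow> sample \<Rightarrow> rvec) \<Rightarrow> bool" where
  "emc_run d X Q \<theta>\<^sub>s n T \<Omega> mh th play \<longleftrightarrow>
     mh \<in> \<Omega> \<rightarrow>\<^sub>M count_space (models d Q) \<and>
     th \<in> \<Omega> \<rightarrow>\<^sub>M borel_vec d \<and>
     (\<forall>t\<in>{n<..T}. play t \<in> \<Omega> \<rightarrow>\<^sub>M arm_space d X) \<and>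
     (\<forall>(x, \<eta>, u) \<in> space \<Omega>.
        let Y = rewards d n \<theta>\<^sub>s x \<eta> in
        is_arg_min (\<lambda>m. (vnorm n (\<lambda>t. Y t - proj n (design d n x ` m) Y t))\<^sup>2)
          (\<lambda>m. m \<in> models d Q) (mh (x, \<eta>, u)) \<and>
        is_arg_min (\<lambda>\<theta>. (vnorm n (\<lambda>t. Y t - design d n x \<theta> t))\<^sup>2)
          (\<lambda>\<theta>. \<theta> \<in> mh (x, \<eta>, u)) (th (x, \<eta>, u)) \<and>
        (\<forall>t\<in>{n<..T}. is_arg_max (\<lambda>z. dot d (th (x, \<eta>, u)) z) (\<lambda>z. z \<in> X) (play t (x, \<eta>, u))))"

definition emc_arm :: "nat \<Rightarrow> (nat \<Rightarrow> sample \<Rightarrow> rvec) \<Rightarrow> nat \<Rightarrow> sample \<Rightarrow> rvec" where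
  "emc_arm n play t \<omega> = (if t \<le> n then fst \<omega> t else play t \<omega>)"

definition regret ::
    "nat \<Rightarrow> rvec \<Rightarrow> rvec \<Rightarrow> nat \<Rightarrow> sample measure \<Rightarrow> (nat \<Rightarrow> sample \<Rightarrow> rvec) \<Rightarrow> real" where
  "regret d \<theta>\<^sub>s x\<^sub>s T \<Omega> arm =
     (\<integral>\<omega>. (\<Sum>t = 1..T. dot d (\<lambda>i. x\<^sub>s i - arm t \<omega> i) \<theta>\<^sub>s) \<partial>\<Omega>)"

definition exploration_length ::
    "real \<Rightarrow> real \<Rightarrow> real \<Rightarrow> real \<Rightarrow> nat \<Rightarrow> nat \<Rightarrow> nat \<Rightarrow> nat" where
  "exploration_length Rmax \<sigma> Cmin Kx d0 d T =
     nat \<lceil>Rmax powr (-2/3) * \<sigma> powr (2/3) * Cmin powr (-1/3) * Kx powr (1/3) * real d0 powr (1/3)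
          * real T powr (2/3) * ln (real d * real T) powr (1/3)\<rceil>"

end

theory Submission
  imports Defs "HOL-Real_Asymp.Real_Asymp"
begin

text \<open>
  Let \<open>\<delta>\<close> be the error of the estimate. Since model and estimate jointly minimise the residual over the
  union of all models, \<open>|X \<delta>|\<^sup>2 \<le> 2 \<langle>\<eta>, X \<delta>\<rangle>\<close>, and \<open>X \<delta>\<close> lies in one of \<open>|Q|\<close> spaces of dimension
  at most \<open>d0 + 1\<close>. A chi-square tail bound and a union bound over the models give
  \<open>|X \<delta>|\<^sup>2 = O(\<sigma>\<^sup>2 d0 ln (d T))\<close> outside an event of probability \<open>1/T\<close>. By Hoeffding's inequality
  \<open>|X \<delta>|\<^sup>2 \<ge> n Cmin |\<delta>|\<^sup>2 / 2\<close> outside an event of probability \<open>O(1/n)\<close>; this is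
  enough because only large \<open>T\<close> matter, so the dimension may enter here through the threshold. As \<open>\<delta>\<close> lies
  in a joined model, a commit round costs at most \<open>2 sqrt Kx |\<delta>|\<close>, and the exploration length
  balances \<open>n\<close> against \<open>T |\<delta>|\<close>.
\<close>

section \<open>Orthonormal bases and projections\<close>

text \<open>Since \<open>\<theta>\<close> is deterministic, the error lies in a model plus the
  single line spanned by \<open>\<theta>\<close>. This is why the dimension is \<open>d0 + 1\<close>
  rather than \<open>2 * d0\<close>, and why the union runs over \<open>Q\<close> and not over
  pairs. Pairs return only when a commit round is priced, where (A2) bounds projections onto joined
  models.

  The obstacle is the random design: the column spaces vary with it, so the Gaussian tail is
  available only conditionally, with an exceptional event for each design. The joint event is
  therefore defined by countably many inequalities, and its sections are compared with the
  conditional events.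

  The constants are kept in two classes. Those that reach \<open>K\<close> come from the noise level
  and depend on \<open>c\<close> and \<open>C0\<close> alone. The dimension, a coordinate bound on
  the arms and the smallest eigenvalue determine the constant \<kappa> of the design event, which is
  fixed before \<open>T\<close> and absorbed by the threshold on \<open>T\<close>.

  As the dimension is a variable, vectors are functions on the naturals and identities between them
  hold on \<open>{1..n}\<close>; linear algebra is developed in this form.\<close>

lemma vnorm_power2: "(vnorm n x)\<^sup>2 = dot n x x"
  by (simp add: vnorm_def dot_def L2_set_def sum_nonneg power2_eq_square)

lemma vnorm_nonneg [simp]: "vnorm n x \<ge> 0"
  by (simp add: vnorm_def)

lemma dot_commute: "dot n x y = dot n y x"
  by (simp add: dot_def mult.commute)

lemma dot_self_nonneg [simp]: "dot n x x \<ge> 0"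
  by (simp add: dot_def sum_nonneg)

lemma dot_self_eq_0: "dot n x x = 0 \<longleftrightarrow> (\<forall>i\<in>{1..n}. x i = 0)"
  by (simp add: dot_def sum_nonneg_eq_0_iff)

lemma dot_cong:
  assumes "\<And>i. i \<in> {1..n} \<Longrightarrow> x i = x' i" "\<And>i. i \<in> {1..n} \<Longrightarrow> y i = y' i"
  shows "dot n x y = dot n x' y'"
  unfolding dot_def using assms by (intro sum.cong) auto

lemma dot_sum_right: "dot n v (\<lambda>i. \<Sum>l\<in>L. a l * e l i) = (\<Sum>l\<in>L. a l * dot n v (e l))"
proof -
  have "dot n v (\<lambda>i. \<Sum>l\<in>L. a l * e l i) = (\<Sum>i=1..n. \<Sum>l\<in>L. a l * (v i * e l i))"
    by (simp add: dot_def sum_distrib_left mult_ac)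
  also have "\<dots> = (\<Sum>l\<in>L. \<Sum>i=1..n. a l * (v i * e l i))"
    by (rule sum.swap)
  finally show ?thesis
    by (simp add: dot_def sum_distrib_left)
qed

lemma dot_diff_left: "dot n (\<lambda>i. x i - y i) z = dot n x z - dot n y z"
  by (simp add: dot_def left_diff_distrib sum_subtractf)

lemma dot_diff_right: "dot n z (\<lambda>i. x i - y i) = dot n z x - dot n z y"
  by (simp add: dot_def right_diff_distrib sum_subtractf)

lemma dot_scale_right: "dot n x (\<lambda>i. c * y i) = c * dot n x y"
  by (simp add: dot_def sum_distrib_left mult_ac)

lemma dot_le_vnorm: "\<bar>dot n x y\<bar> \<le> vnorm n x * vnorm n y"
proof -
  have "\<bar>dot n x y\<bar> \<le> (\<Sum>i=1..n. \<bar>x i\<bar> * \<bar>y i\<bar>)"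
    unfolding dot_def by (rule order.trans[OF sum_abs]) (simp add: abs_mult)
  then show ?thesis
    unfolding vnorm_def using L2_set_mult_ineq[of x y "{1..n}"] by linarith
qed

section \<open>Orthonormal families and Gram-Schmidt\<close>

definition orthonormal :: "nat \<Rightarrow> nat \<Rightarrow> (nat \<Rightarrow> rvec) \<Rightarrow> bool" where
  "orthonormal n k e \<longleftrightarrow> (\<forall>l<k. \<forall>m<k. dot n (e l) (e m) = (if l = m then 1 else 0))"

lemma orthonormal_dot_combination:
  assumes "orthonormal n k e" "m < k"
  shows "dot n (e m) (\<lambda>i. \<Sum>l<k. a l * e l i) = a m"
proof -
  have "dot n (e m) (\<lambda>i. \<Sum>l<k. a l * e l i) = (\<Sum>l<k. if l = m then a l else 0)"
    unfolding dot_sum_right using assms by (intro sum.cong) (auto simp: orthonormal_def)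
  then show ?thesis
    using assms by simp
qed

lemma orthonormal_dot_self_combination:
  assumes "orthonormal n k e"
  shows "dot n (\<lambda>i. \<Sum>l<k. a l * e l i) (\<lambda>i. \<Sum>l<k. a l * e l i) = (\<Sum>l<k. (a l)\<^sup>2)"
  by (subst dot_sum_right, rule sum.cong)
    (use assms orthonormal_dot_combination in
      \<open>auto simp: dot_commute[of n "\<lambda>i. \<Sum>l<k. a l * e l i"] power2_eq_square\<close>)

text \<open>Recording expansions in both directions makes the two spans equal. A vector that depends
  on its predecessors adds nothing to the basis, so \<open>k\<close> may stay below
  \<open>r\<close>; this matters because generators of a model can become dependent under the
  design.\<close>

lemma gram_schmidt:
  "\<exists>k\<le>r. \<exists>e. orthonormal n k e
     \<and> (\<forall>j<r. \<exists>a. \<forall>i\<in>{1..n}. f j i = (\<Sum>l<k. a l * e l i))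
     \<and> (\<forall>l<k. \<exists>b. \<forall>i\<in>{1..n}. e l i = (\<Sum>j<r. b j * f j i))"
proof (induction r)
  case 0
  show ?case by (auto simp: orthonormal_def)
next
  case (Suc r)
  then obtain k e where k: "k \<le> r" and on: "orthonormal n k e"
    and fe: "\<And>j. j < r \<Longrightarrow> \<exists>a. \<forall>i\<in>{1..n}. f j i = (\<Sum>l<k. a l * e l i)"
    and ef: "\<And>l. l < k \<Longrightarrow> \<exists>b. \<forall>i\<in>{1..n}. e l i = (\<Sum>j<r. b j * f j i)"
    by blast
  define w where "w = (\<lambda>i. f r i - (\<Sum>l<k. dot n (f r) (e l) * e l i))"
  have ef': "\<exists>b. \<forall>i\<in>{1..n}. e l i = (\<Sum>j<Suc r. b j * f j i)" if "l < k" for l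
  proof -
    from ef[OF that] obtain b where "\<forall>i\<in>{1..n}. e l i = (\<Sum>j<r. b j * f j i)" ..
    then show ?thesis
      by (intro exI[of _ "b(r := 0)"]) simp
  qed
  have we: "dot n (e m) w = 0" if "m < k" for m
    unfolding w_def dot_diff_right orthonormal_dot_combination[OF on that]
    by (simp add: dot_commute)
  show ?case
  proof (cases "dot n w w = 0")
    case True
    then have "\<forall>i\<in>{1..n}. f r i = (\<Sum>l<k. dot n (f r) (e l) * e l i)"
      unfolding dot_self_eq_0 by (simp add: w_def)
    then have "\<exists>a. \<forall>i\<in>{1..n}. f j i = (\<Sum>l<k. a l * e l i)" if "j < Suc r" for j
      using that fe by (auto simp: less_Suc_eq)
    then show ?thesis
      using k on ef' by (intro exI[of _ k] conjI exI[of _ e]) auto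
  next
    case False
    define N where "N = sqrt (dot n w w)"
    have N: "N > 0" "N * N = dot n w w"
      using False dot_self_nonneg[of n w] by (auto simp: N_def less_le)
    define e' where "e' = e(k := \<lambda>i. (1 / N) * w i)"
    have e'_old: "e' l = e l" if "l < k" for l
      using that by (simp add: e'_def)
    have e'_new: "e' k = (\<lambda>i. (1 / N) * w i)"
      by (simp add: e'_def)
    have on': "orthonormal n (Suc k) e'"
    proof -
      have new: "dot n (e' k) (e' k) = 1"
        unfolding e'_new dot_scale_right dot_commute[of n "\<lambda>i. (1 / N) * w i" w]
        using N(1) by (simp add: N(2)[symmetric])
      have mix: "dot n (e l) (e' k) = 0" if "l < k" for l
        unfolding e'_new dot_scale_right using we[OF that] by simp
      then have mix': "dot n (e' k) (e l) = 0" if "l < k" for l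
        using that by (simp add: dot_commute[of n "e' k" "e l"])
      show ?thesis
        unfolding orthonormal_def
        using new mix mix' on e'_old by (auto simp: less_Suc_eq orthonormal_def)
    qed
    have fr: "f r i = (\<Sum>l<k. dot n (f r) (e l) * e l i) + N * e' k i" for i
      using N by (simp add: e'_new w_def)
    have 1: "\<exists>a. \<forall>i\<in>{1..n}. f j i = (\<Sum>l<Suc k. a l * e' l i)" if "j < Suc r" for j
    proof (cases "j = r")
      case True
      show ?thesis
        by (rule exI[of _ "(\<lambda>l. dot n (f r) (e l))(k := N)"])
          (auto simp: True fr e'_old intro!: sum.cong)
    next
      case False
      with that have "j < r" by simp
      from fe[OF this] obtain a where a: "\<forall>i\<in>{1..n}. f j i = (\<Sum>l<k. a l * e l i)" ..
      show ?thesis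
        by (rule exI[of _ "a(k := 0)"]) (auto simp: a e'_old intro!: sum.cong)
    qed
    have 2: "\<exists>b. \<forall>i\<in>{1..n}. e' l i = (\<Sum>j<Suc r. b j * f j i)" if "l < Suc k" for l
    proof (cases "l = k")
      case True
      obtain b where b: "\<forall>m<k. \<forall>i\<in>{1..n}. e m i = (\<Sum>j<r. b m j * f j i)"
        using ef by metis
      define c where "c = (\<lambda>j. \<Sum>m<k. dot n (f r) (e m) * b m j)"
      show ?thesis
      proof (rule exI[of _ "(\<lambda>j. - (1 / N) * c j)(r := 1 / N)"], rule ballI)
        fix i assume i: "i \<in> {1..n}"
        have "(\<Sum>m<k. dot n (f r) (e m) * e m i)
            = (\<Sum>m<k. \<Sum>j<r. dot n (f r) (e m) * b m j * f j i)"
          using b i by (simp add: sum_distrib_left mult_ac)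
        also have "\<dots> = (\<Sum>j<r. c j * f j i)"
          unfolding c_def by (subst sum.swap) (simp add: sum_distrib_right)
        finally have "e' l i = (1 / N) * (f r i - (\<Sum>j<r. c j * f j i))"
          by (simp add: True e'_new w_def)
        also have "\<dots> = (\<Sum>j<r. (- (1 / N) * c j) * f j i) + (1 / N) * f r i"
          by (simp only: right_diff_distrib sum_distrib_left mult.assoc mult_minus_left sum_negf)
        finally show "e' l i = (\<Sum>j<Suc r. ((\<lambda>j. - (1 / N) * c j)(r := 1 / N)) j * f j i)"
          by simp
      qed
    next
      case False
      then show ?thesis
        using that ef' e'_old by auto
    qed
    show ?thesis
      using k on' 1 2 by (intro exI[of _ "Suc k"] conjI exI[of _ e']) auto
  qed
qed

text \<open>The span of \<open>f 0, ..., f (r - 1)\<close> inside \<open>vecs n\<close>. Generators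
  may be dependent, so \<open>r\<close> only bounds the dimension; they are compared with
  \<open>v\<close> on \<open>{1..n}\<close> alone and need not be extensional themselves.\<close>

definition gen_space :: "nat \<Rightarrow> nat \<Rightarrow> (nat \<Rightarrow> rvec) \<Rightarrow> rvec set" where
  "gen_space n r f = {v \<in> vecs n. \<exists>a. \<forall>i\<in>{1..n}. v i = (\<Sum>j<r. a j * f j i)}"

lemma gen_spaceI:
  assumes "v \<in> vecs n" "\<And>i. i \<in> {1..n} \<Longrightarrow> v i = (\<Sum>j<r. a j * f j i)"
  shows "v \<in> gen_space n r f"
  unfolding gen_space_def using assms by (intro CollectI conjI exI[of _ a]) auto

lemma gen_spaceE:
  assumes "v \<in> gen_space n r f"
  obtains a where "v \<in> vecs n" "\<forall>i\<in>{1..n}. v i = (\<Sum>j<r. a j * f j i)"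
  using assms unfolding gen_space_def by (elim CollectE conjE exE)

lemma restrict_in_vecs [simp]: "restrict x {Suc 0..n} \<in> vecs n"
  by (simp add: vecs_def)

lemma gen_space_subset:
  assumes "\<forall>j<r. \<exists>a. \<forall>i\<in>{1..n}. f j i = (\<Sum>l<k. a l * e l i)"
  shows "gen_space n r f \<subseteq> gen_space n k e"
proof
  fix v assume "v \<in> gen_space n r f"
  then obtain b where v: "v \<in> vecs n" "\<forall>i\<in>{1..n}. v i = (\<Sum>j<r. b j * f j i)"
    by (rule gen_spaceE)
  obtain a where a: "\<forall>j<r. \<forall>i\<in>{1..n}. f j i = (\<Sum>l<k. a j l * e l i)"
    using assms by metis
  have "v i = (\<Sum>l<k. (\<Sum>j<r. b j * a j l) * e l i)" if i: "i \<in> {1..n}" for i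
  proof -
    have "v i = (\<Sum>j<r. \<Sum>l<k. b j * a j l * e l i)"
      using v a i by (simp add: sum_distrib_left mult_ac)
    also have "\<dots> = (\<Sum>l<k. (\<Sum>j<r. b j * a j l) * e l i)"
      by (subst sum.swap) (simp add: sum_distrib_right)
    finally show ?thesis .
  qed
  then show "v \<in> gen_space n k e"
    by (intro gen_spaceI[OF v(1)])
qed

lemma gen_space_orthonormal:
  obtains k e where "k \<le> r" "orthonormal n k e" "gen_space n r f = gen_space n k e"
proof -
  from gram_schmidt[of r n f] show ?thesis
    by (elim exE conjE) (rule that, assumption+, intro subset_antisym gen_space_subset)
qed

lemma orthonormal_residual:
  assumes "orthonormal n k e" "w \<in> gen_space n k e"
  shows "dot n (\<lambda>i. v i - (\<Sum>l<k. dot n v (e l) * e l i)) w = 0"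
proof -
  from assms(2) obtain a where "\<forall>i\<in>{1..n}. w i = (\<Sum>l<k. a l * e l i)"
    by (rule gen_spaceE)
  then have a: "\<And>i. i \<in> {1..n} \<Longrightarrow> w i = (\<Sum>l<k. a l * e l i)"
    by blast
  have "dot n (\<lambda>i. v i - (\<Sum>l<k. dot n v (e l) * e l i)) (e l) = 0" if "l < k" for l
    unfolding dot_diff_left dot_commute[of n "\<lambda>i. \<Sum>l<k. dot n v (e l) * e l i"]
      orthonormal_dot_combination[OF assms(1) that] by simp
  then have "dot n (\<lambda>i. v i - (\<Sum>l<k. dot n v (e l) * e l i)) (\<lambda>i. \<Sum>l<k. a l * e l i) = 0"
    by (simp add: dot_sum_right)
  then show ?thesis
    using a by (subst dot_cong[of n _ _ w, OF refl a]) auto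
qed

lemma gen_space_diff:
  assumes "v \<in> gen_space n r f" "w \<in> gen_space n r f"
  shows "(\<lambda>i\<in>{1..n}. v i - w i) \<in> gen_space n r f"
proof -
  obtain a where "\<forall>i\<in>{1..n}. v i = (\<Sum>j<r. a j * f j i)"
    using assms(1) by (rule gen_spaceE)
  moreover obtain b where "\<forall>i\<in>{1..n}. w i = (\<Sum>j<r. b j * f j i)"
    using assms(2) by (rule gen_spaceE)
  ultimately show ?thesis
    by (intro gen_spaceI[where a = "\<lambda>j. a j - b j"]) (simp_all add: left_diff_distrib sum_subtractf)
qed

lemma proj_orthonormal:
  fixes v :: rvec
  assumes on: "orthonormal n k e"
  defines "S \<equiv> gen_space n k e"
  defines "p \<equiv> \<lambda>i\<in>{1..n}. \<Sum>l<k. dot n v (e l) * e l i"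
  shows "proj n S v = p"
    and "\<And>w. w \<in> S \<Longrightarrow> vnorm n (\<lambda>i. v i - p i) \<le> vnorm n (\<lambda>i. v i - w i)"
proof -
  have pS: "p \<in> S"
    unfolding S_def p_def by (rule gen_spaceI[where a = "\<lambda>l. dot n v (e l)"]) simp_all
  \<comment> \<open>Pythagoras, as \<open>v - p\<close> is orthogonal to the space. It yields
    minimality of \<open>p\<close> and, read backwards, uniqueness: equal distances force
    \<open>p - w\<close> to vanish.\<close>
  have pyth: "(vnorm n (\<lambda>i. v i - w i))\<^sup>2 = (vnorm n (\<lambda>i. v i - p i))\<^sup>2 + dot n (\<lambda>i. p i - w i) (\<lambda>i. p i - w i)"
    if w: "w \<in> S" for w
  proof -
    have "dot n (\<lambda>i. v i - (\<Sum>l<k. dot n v (e l) * e l i)) (\<lambda>i\<in>{1..n}. p i - w i) = 0"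
      using orthonormal_residual[OF on, of _ v] gen_space_diff pS w unfolding S_def by blast
    then have "dot n (\<lambda>i. v i - p i) (\<lambda>i. p i - w i) = 0"
      using dot_cong[of n "\<lambda>i. v i - p i" "\<lambda>i. v i - (\<Sum>l<k. dot n v (e l) * e l i)"
          "\<lambda>i. p i - w i" "\<lambda>i\<in>{1..n}. p i - w i"] by (simp add: p_def)
    moreover have "dot n (\<lambda>i. v i - w i) (\<lambda>i. v i - w i) =
      dot n (\<lambda>i. v i - p i) (\<lambda>i. v i - p i) + dot n (\<lambda>i. p i - w i) (\<lambda>i. p i - w i)
        + 2 * dot n (\<lambda>i. v i - p i) (\<lambda>i. p i - w i)"
      unfolding dot_def sum_distrib_left sum.distrib[symmetric]
      by (intro sum.cong) (auto simp: algebra_simps)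
    ultimately show ?thesis
      by (simp add: vnorm_power2)
  qed
  show le: "vnorm n (\<lambda>i. v i - p i) \<le> vnorm n (\<lambda>i. v i - w i)" if "w \<in> S" for w
    by (rule power2_le_imp_le) (simp_all add: pyth[OF that])
  have "is_arg_min (\<lambda>w. vnorm n (\<lambda>i. v i - w i)) (\<lambda>w. w \<in> S) p"
    using pS le by (auto simp: is_arg_min_linorder)
  \<comment> \<open>\<open>arg_min\<close> is a choice; the minimiser \<open>p\<close> guarantees
    that the chosen point is a minimiser. Pythagoras identifies the two on \<open>{1..n}\<close>,
    extensionality elsewhere.\<close>
  then have *: "is_arg_min (\<lambda>w. vnorm n (\<lambda>i. v i - w i)) (\<lambda>w. w \<in> S) (proj n S v)"
    unfolding proj_def arg_min_def by (rule someI[where P = "is_arg_min _ _"])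
  then have qS: "proj n S v \<in> S" and "vnorm n (\<lambda>i. v i - proj n S v i) \<le> vnorm n (\<lambda>i. v i - p i)"
    using pS by (auto simp: is_arg_min_linorder)
  then have "(vnorm n (\<lambda>i. v i - proj n S v i))\<^sup>2 \<le> (vnorm n (\<lambda>i. v i - p i))\<^sup>2"
    by (intro power_mono) auto
  with pyth[OF qS] have "dot n (\<lambda>i. p i - proj n S v i) (\<lambda>i. p i - proj n S v i) = 0"
    using dot_self_nonneg[of n "\<lambda>i. p i - proj n S v i"] by linarith
  then have "\<forall>i\<in>{1..n}. p i = proj n S v i"
    by (simp add: dot_self_eq_0)
  moreover have "p \<in> vecs n" "proj n S v \<in> vecs n"
    using pS qS by (auto simp: S_def gen_space_def)
  ultimately show "proj n S v = p"
    unfolding vecs_def by (intro PiE_ext[of "proj n S v" _ _ p]) auto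
qed

text \<open>The normal equations and minimality: besides membership, these are the facts about
  \<open>proj\<close> that the statistical part uses. The orthonormal basis stays inside the
  proof.\<close>

lemma proj_gen_space:
  assumes "w \<in> gen_space n r f"
  shows "dot n (proj n (gen_space n r f) v) w = dot n v w"
    and "vnorm n (\<lambda>i. v i - proj n (gen_space n r f) v i) \<le> vnorm n (\<lambda>i. v i - w i)"
proof -
  obtain k e where on: "orthonormal n k e" and S: "gen_space n r f = gen_space n k e"
    by (rule gen_space_orthonormal)
  show "vnorm n (\<lambda>i. v i - proj n (gen_space n r f) v i) \<le> vnorm n (\<lambda>i. v i - w i)"
    using proj_orthonormal(2)[OF on, of w v] assms by (simp only: S proj_orthonormal(1)[OF on])
  have "dot n (proj n (gen_space n r f) v) w = dot n (\<lambda>i. \<Sum>l<k. dot n v (e l) * e l i) w"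
    unfolding S proj_orthonormal(1)[OF on] by (rule dot_cong) auto
  then show "dot n (proj n (gen_space n r f) v) w = dot n v w"
    using orthonormal_residual[OF on, of w v] assms by (simp add: S dot_diff_left)
qed

text \<open>The indicators of the classes are the generators: covering and disjointness leave
  exactly one nonzero summand at each coordinate. Their number \<open>card p\<close> later enters
  the tail bound as the dimension.\<close>

lemma fixed_space_gen:
  assumes p: "partition_on {1..d} p"
  obtains f where "fixed_space d p = gen_space d (card p) f"
proof -
  have "finite p"
    using finite_elements[OF _ p] by simp
  then obtain b where b: "bij_betw b {..<card p} p"
    using ex_bij_betw_nat_finite[of p] by (auto simp: atLeast0LessThan)
  define f where "f = (\<lambda>j i. if i \<in> b j then 1 else (0::real))"
  have blk: "(\<Sum>j<card p. a j * f j i) = a j0" if "j0 < card p" "i \<in> b j0" for a i j0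
  proof -
    have "i \<notin> b j" if "j < card p" "j \<noteq> j0" for j
    proof
      assume "i \<in> b j"
      moreover have "b j \<in> p" "b j0 \<in> p" "b j \<noteq> b j0"
        using b that \<open>j0 < card p\<close> by (auto simp: bij_betw_def inj_on_def)
      ultimately show False
        using p \<open>i \<in> b j0\<close> by (auto simp: partition_on_def disjoint_def)
    qed
    then have "(\<Sum>j<card p. a j * f j i) = (\<Sum>j<card p. if j = j0 then a j else 0)"
      using that by (intro sum.cong) (auto simp: f_def)
    then show ?thesis
      using that by simp
  qed
  have ex: "\<exists>j<card p. i \<in> b j" if i: "i \<in> {1..d}" for i
  proof -
    have "i \<in> \<Union>p"
      using p i by (simp add: partition_on_def)
    then obtain B where "B \<in> p" "i \<in> B"
      by (auto simp: partition_on_def)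
    then show ?thesis
      using b by (auto simp: bij_betw_def image_iff)
  qed
  have sub: "b j \<subseteq> {1..d}" "b j \<noteq> {}" "b j \<in> p" if "j < card p" for j
  proof -
    show "b j \<in> p" using b that by (auto simp: bij_betw_def)
    then show "b j \<subseteq> {1..d}" "b j \<noteq> {}" using p by (auto simp: partition_on_def)
  qed
  have "fixed_space d p = gen_space d (card p) f"
  proof (intro Set.set_eqI iffI)
    fix v assume v: "v \<in> fixed_space d p"
    have "v i = (\<Sum>j<card p. v (SOME i'. i' \<in> b j) * f j i)" if i: "i \<in> {1..d}" for i
    proof -
      obtain j where j: "j < card p" "i \<in> b j" using ex[OF i] by blast
      have "(SOME i'. i' \<in> b j) \<in> b j" using j by (intro someI)
      have "\<forall>B\<in>p. \<forall>i\<in>B. \<forall>j\<in>B. v i = v j"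
        using v unfolding fixed_space_def by (elim CollectE conjE)
      with sub(3)[OF j(1)] j(2) \<open>(SOME i'. i' \<in> b j) \<in> b j\<close> have "v i = v (SOME i'. i' \<in> b j)"
        by blast
      then show ?thesis
        unfolding blk[OF j] .
    qed
    moreover have "v \<in> vecs d"
      using v unfolding fixed_space_def by (elim CollectE conjE)
    ultimately show "v \<in> gen_space d (card p) f"
      by (intro gen_spaceI)
  next
    fix v assume "v \<in> gen_space d (card p) f"
    then obtain a where v: "v \<in> vecs d" "\<forall>i\<in>{1..d}. v i = (\<Sum>j<card p. a j * f j i)"
      by (rule gen_spaceE)
    have "v i = v i'" if B: "B \<in> p" "i \<in> B" "i' \<in> B" for B i i'
    proof -
      have "B \<in> b ` {..<card p}"
        using b B(1) by (simp add: bij_betw_def)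
      then obtain j where j: "j < card p" "b j = B"
        by auto
      then have "i \<in> {1..d}" "i' \<in> {1..d}"
        using sub(1)[of j] B by auto
      then have "v i = (\<Sum>j<card p. a j * f j i)" "v i' = (\<Sum>j<card p. a j * f j i')"
        using v(2) by blast+
      then show ?thesis
        using blk[of j i a] blk[of j i' a] j B by simp
    qed
    then show "v \<in> fixed_space d p"
      unfolding fixed_space_def using v(1) by (intro CollectI conjI ballI)
  qed
  then show ?thesis
    by (rule that)
qed

definition append_gens :: "nat \<Rightarrow> (nat \<Rightarrow> rvec) \<Rightarrow> (nat \<Rightarrow> rvec) \<Rightarrow> nat \<Rightarrow> rvec" where
  "append_gens r f g = (\<lambda>j. if j < r then f j else g (j - r))"

lemma sum_append_gens:
  "(\<Sum>j<r + s. a j * append_gens r f g j i) = (\<Sum>j<r. a j * f j i) + (\<Sum>j<s. a (j + r) * g j i)"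
proof -
  have "(\<Sum>j<r + s. a j * append_gens r f g j i)
      = (\<Sum>j<r. a j * append_gens r f g j i) + (\<Sum>j=r..<r + s. a j * append_gens r f g j i)"
    by (simp add: lessThan_atLeast0 sum.atLeastLessThan_concat)
  also have "(\<Sum>j=r..<r + s. a j * append_gens r f g j i)
      = (\<Sum>j<s. a (j + r) * append_gens r f g (j + r) i)"
    using sum.shift_bounds_nat_ivl[of "\<lambda>j. a j * append_gens r f g j i" 0 r s]
    by (simp add: lessThan_atLeast0 add.commute)
  finally show ?thesis
    by (simp add: append_gens_def)
qed

lemma gen_space_append:
  assumes "v \<in> gen_space n r f" "w \<in> gen_space n s g"
  shows "(\<lambda>i\<in>{1..n}. \<alpha> * v i + \<beta> * w i) \<in> gen_space n (r + s) (append_gens r f g)"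
proof -
  obtain a where a: "\<forall>i\<in>{1..n}. v i = (\<Sum>j<r. a j * f j i)"
    using assms(1) by (rule gen_spaceE)
  obtain b where b: "\<forall>i\<in>{1..n}. w i = (\<Sum>j<s. b j * g j i)"
    using assms(2) by (rule gen_spaceE)
  show ?thesis
    by (rule gen_spaceI[where a = "\<lambda>j. if j < r then \<alpha> * a j else \<beta> * b (j - r)"])
      (simp_all add: sum_append_gens a b sum_distrib_left mult.assoc)
qed

lemma gen_space_zero: "(\<lambda>i\<in>{1..n}. 0) \<in> gen_space n r f"
  by (rule gen_spaceI[where a = "\<lambda>_. 0"]) simp_all

text \<open>The hull of the union of two subspaces is their sum, because \<open>x + y\<close> is the
  midpoint of \<open>2 * x\<close> and \<open>2 * y\<close>. This turns the hulls in
  \<open>joined_models\<close> into spans, to which the projection lemmas apply.\<close>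

lemma convex_hull_gen_space:
  "convex_vec n hull (gen_space n r f \<union> gen_space n s g) = gen_space n (r + s) (append_gens r f g)"
    (is "_ = ?S")
proof
  have ext: "v = (\<lambda>i\<in>{1..n}. v i)" if "v \<in> vecs n" for v
    using that by (auto simp: vecs_def PiE_def extensional_def)
  have "convex_vec n ?S"
    unfolding convex_vec_def
  proof (intro ballI allI impI)
    fix x y u v assume "x \<in> ?S" "y \<in> ?S"
    obtain a where a: "\<forall>i\<in>{1..n}. x i = (\<Sum>j<r + s. a j * append_gens r f g j i)"
      using \<open>x \<in> ?S\<close> by (rule gen_spaceE)
    obtain b where b: "\<forall>i\<in>{1..n}. y i = (\<Sum>j<r + s. b j * append_gens r f g j i)"
      using \<open>y \<in> ?S\<close> by (rule gen_spaceE)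
    show "(\<lambda>i\<in>{1..n}. u * x i + v * y i) \<in> ?S"
      by (rule gen_spaceI[where a = "\<lambda>j. u * a j + v * b j"])
        (simp_all add: a b sum_distrib_left sum.distrib distrib_right mult.assoc)
  qed
  moreover have "gen_space n r f \<union> gen_space n s g \<subseteq> ?S"
  proof
    fix v assume "v \<in> gen_space n r f \<union> gen_space n s g"
    then have "v = (\<lambda>i\<in>{1..n}. v i)"
      by (intro ext) (auto simp: gen_space_def)
    moreover have "(\<lambda>i\<in>{1..n}. v i) \<in> ?S"
      using \<open>v \<in> gen_space n r f \<union> gen_space n s g\<close>
    proof
      assume "v \<in> gen_space n r f"
      from gen_space_append[OF this gen_space_zero, of 1 0] show ?thesis
        by simp
    next
      assume "v \<in> gen_space n s g"
      from gen_space_append[OF gen_space_zero this, of 0 1] show ?thesis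
        by simp
    qed
    ultimately show "v \<in> ?S" by simp
  qed
  ultimately show "convex_vec n hull (gen_space n r f \<union> gen_space n s g) \<subseteq> ?S"
    by (intro hull_minimal)
  show "?S \<subseteq> convex_vec n hull (gen_space n r f \<union> gen_space n s g)"
  proof
    fix v assume v: "v \<in> ?S"
    then obtain a where a: "\<forall>i\<in>{1..n}. v i = (\<Sum>j<r + s. a j * append_gens r f g j i)"
      by (rule gen_spaceE)
    define x where "x = (\<lambda>i\<in>{1..n}. \<Sum>j<r. (2 * a j) * f j i)"
    define y where "y = (\<lambda>i\<in>{1..n}. \<Sum>j<s. (2 * a (j + r)) * g j i)"
    have x: "x \<in> gen_space n r f"
      unfolding x_def by (rule gen_spaceI[where a = "\<lambda>j. 2 * a j"]) simp_all
    have y: "y \<in> gen_space n s g"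
      unfolding y_def by (rule gen_spaceI[where a = "\<lambda>j. 2 * a (j + r)"]) simp_all
    have "v = (\<lambda>i\<in>{1..n}. v i)"
      using v by (intro ext) (auto simp: gen_space_def)
    also have "\<dots> = (\<lambda>i\<in>{1..n}. (1/2) * x i + (1/2) * y i)"
      using a by (intro restrict_ext) (simp add: sum_append_gens x_def y_def sum_distrib_left mult.assoc)
    also have "\<dots> \<in> T" if "convex_vec n T" "gen_space n r f \<union> gen_space n s g \<subseteq> T" for T
    proof -
      have "x \<in> T" "y \<in> T" using x y that by auto
      with that(1)[unfolded convex_vec_def, rule_format, of x y "1/2" "1/2"] show ?thesis
        by simp
    qed
    finally show "v \<in> convex_vec n hull (gen_space n r f \<union> gen_space n s g)"
      unfolding hull_def by blast
  qed
qed

lemma dot_combination_right: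
  assumes "\<forall>i\<in>{1..d}. v i = (\<Sum>j\<in>J. a j * f j i)"
  shows "dot d u v = (\<Sum>j\<in>J. a j * dot d u (f j))"
proof -
  have "dot d u v = dot d u (\<lambda>i. \<Sum>j\<in>J. a j * f j i)"
    using assms by (intro dot_cong) auto
  then show ?thesis
    by (simp add: dot_sum_right)
qed

text \<open>Presents the column space of a model as a span with the same number of generators, so
  that \<open>proj_gen_space\<close> covers the projection of the rewards.\<close>

lemma design_gen_space:
  "design d n x ` gen_space d r f = gen_space n r (\<lambda>j. design d n x (f j))"
proof (intro Set.set_eqI iffI)
  fix w assume "w \<in> design d n x ` gen_space d r f"
  then obtain v where w: "w = design d n x v" and "v \<in> gen_space d r f"
    by blast
  from this(2) obtain a where v: "\<forall>i\<in>{1..d}. v i = (\<Sum>j<r. a j * f j i)"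
    by (rule gen_spaceE)
  have "w t = (\<Sum>j<r. a j * design d n x (f j) t)" if "t \<in> {1..n}" for t
    using that dot_combination_right[OF v] by (simp add: w design_def)
  then show "w \<in> gen_space n r (\<lambda>j. design d n x (f j))"
    by (intro gen_spaceI) (simp_all add: w design_def)
next
  fix w assume "w \<in> gen_space n r (\<lambda>j. design d n x (f j))"
  then obtain a where wv: "w \<in> vecs n"
    and w: "\<forall>t\<in>{1..n}. w t = (\<Sum>j<r. a j * design d n x (f j) t)"
    by (rule gen_spaceE)
  define v where "v = (\<lambda>i\<in>{1..d}. \<Sum>j<r. a j * f j i)"
  have v: "v \<in> gen_space d r f"
    unfolding v_def by (rule gen_spaceI[where a = a]) simp_all
  have "w t = design d n x v t" for t
  proof (cases "t \<in> {1..n}")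
    case True
    then show ?thesis
      using w dot_combination_right[where d = d and v = v and J = "{..<r}" and a = a and f = f and u = "x t"] by (simp add: design_def v_def)
  next
    case False
    then show ?thesis
      using wv by (auto simp: vecs_def PiE_def extensional_def design_def)
  qed
  then show "w \<in> design d n x ` gen_space d r f"
    using v by blast
qed

section \<open>Gaussian tails on subspaces\<close>

abbreviation gauss :: "real \<Rightarrow> real measure" where
  "gauss \<sigma> \<equiv> density lborel (\<lambda>z. ennreal (normal_density 0 \<sigma> z))"

abbreviation gauss_vec :: "nat set \<Rightarrow> real \<Rightarrow> rvec measure" where
  "gauss_vec I \<sigma> \<equiv> Pi\<^sub>M I (\<lambda>_. gauss \<sigma>)"

lemma nn_integral_normal_density:
  assumes "\<sigma> > 0"
  shows "(\<integral>\<^sup>+z. ennreal (normal_density \<mu> \<sigma> z) \<partial>lborel) = 1"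
  using nn_integral_eq_integral[OF integrable_normal_density[OF assms, of \<mu>]] assms by simp

text \<open>Completing the square: the factor \<open>exp (a * z)\<close> moves the mean of the
  density to \<open>a * \<sigma>\<^sup>2\<close>.\<close>

lemma gauss_mgf:
  assumes \<sigma>: "\<sigma> > 0"
  shows "(\<integral>\<^sup>+z. ennreal (exp (a * z)) \<partial>gauss \<sigma>) = ennreal (exp (a\<^sup>2 * \<sigma>\<^sup>2 / 2))"
proof -
  have "normal_density 0 \<sigma> z * exp (a * z)
      = exp (a\<^sup>2 * \<sigma>\<^sup>2 / 2) * normal_density (a * \<sigma>\<^sup>2) \<sigma> z" for z
  proof -
    have "- z\<^sup>2 / (2 * \<sigma>\<^sup>2) + a * z = a\<^sup>2 * \<sigma>\<^sup>2 / 2 + - (z - a * \<sigma>\<^sup>2)\<^sup>2 / (2 * \<sigma>\<^sup>2)"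
      using \<sigma> by (simp add: field_simps power2_eq_square)
    then have "exp (- z\<^sup>2 / (2 * \<sigma>\<^sup>2)) * exp (a * z)
        = exp (a\<^sup>2 * \<sigma>\<^sup>2 / 2) * exp (- (z - a * \<sigma>\<^sup>2)\<^sup>2 / (2 * \<sigma>\<^sup>2))"
      by (simp only: exp_add[symmetric])
    then show ?thesis
      by (simp add: normal_density_def)
  qed
  then have "(\<integral>\<^sup>+z. ennreal (exp (a * z)) \<partial>gauss \<sigma>)
      = (\<integral>\<^sup>+z. ennreal (exp (a\<^sup>2 * \<sigma>\<^sup>2 / 2)) * ennreal (normal_density (a * \<sigma>\<^sup>2) \<sigma> z) \<partial>lborel)"
    by (subst nn_integral_density) (simp_all add: ennreal_mult[symmetric])
  then show ?thesis
    using nn_integral_normal_density[OF \<sigma>] by (simp add: nn_integral_cmult)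
qed

text \<open>The exponent \<open>1/4\<close> is half of the critical \<open>1/2\<close>: times the
  standard normal density it gives \<open>sqrt 2\<close> times a normal density of variance 2. Every
  \<open>sqrt 2\<close> in the tail bounds originates here.\<close>

lemma gauss_exp_square: "(\<integral>\<^sup>+z. ennreal (exp (z\<^sup>2 / 4)) \<partial>gauss 1) = ennreal (sqrt 2)"
proof -
  have "normal_density 0 1 z * exp (z\<^sup>2 / 4) = sqrt 2 * normal_density 0 (sqrt 2) z" for z
  proof -
    have "exp (- z\<^sup>2 / 2) * exp (z\<^sup>2 / 4) = exp (- z\<^sup>2 / 4)"
      by (simp add: exp_add[symmetric])
    moreover have "x / (t * y) = t * x / (t\<^sup>2 * y)" if "t > 0" for t x y :: real
      using that by (simp add: power2_eq_square)
    from this[of "sqrt 2"] have "x / (sqrt 2 * y) = sqrt 2 * x / (2 * y)" for x y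
      by simp
    ultimately show ?thesis
      by (simp add: normal_density_def real_sqrt_mult)
  qed
  then have "(\<integral>\<^sup>+z. ennreal (exp (z\<^sup>2 / 4)) \<partial>gauss 1)
      = (\<integral>\<^sup>+z. ennreal (sqrt 2) * ennreal (normal_density 0 (sqrt 2) z) \<partial>lborel)"
    by (subst nn_integral_density) (simp_all add: ennreal_mult[symmetric])
  then show ?thesis
    using nn_integral_normal_density[of "sqrt 2"] by (simp add: nn_integral_cmult)
qed

lemma prob_space_gauss_vec:
  assumes "\<sigma> > 0"
  shows "prob_space (gauss_vec I \<sigma>)"
  using prob_space_normal_density[OF assms] by (intro prob_space_PiM)

lemma product_sigma_finite_gauss:
  assumes "\<sigma> > 0"
  shows "product_sigma_finite (\<lambda>_. gauss \<sigma>)"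
  unfolding product_sigma_finite_def
  using prob_space_normal_density[OF assms] prob_space_imp_sigma_finite by blast

lemma gauss_vec_mgf:
  assumes \<sigma>: "\<sigma> > 0" and I: "finite I"
  shows "(\<integral>\<^sup>+\<eta>. ennreal (exp (\<Sum>i\<in>I. w i * \<eta> i)) \<partial>gauss_vec I \<sigma>)
    = ennreal (exp (\<sigma>\<^sup>2 * (\<Sum>i\<in>I. (w i)\<^sup>2) / 2))"
proof -
  interpret product_sigma_finite "\<lambda>_::nat. gauss \<sigma>"
    by (rule product_sigma_finite_gauss[OF \<sigma>])
  have "(\<integral>\<^sup>+\<eta>. ennreal (exp (\<Sum>i\<in>I. w i * \<eta> i)) \<partial>gauss_vec I \<sigma>)
      = (\<integral>\<^sup>+\<eta>. (\<Prod>i\<in>I. ennreal (exp (w i * \<eta> i))) \<partial>gauss_vec I \<sigma>)"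
    by (simp add: exp_sum I prod_ennreal)
  also have "\<dots> = (\<Prod>i\<in>I. ennreal (exp ((w i)\<^sup>2 * \<sigma>\<^sup>2 / 2)))"
    using I by (subst product_nn_integral_prod) (simp_all add: gauss_mgf[OF \<sigma>])
  also have "\<dots> = ennreal (exp (\<Sum>i\<in>I. (w i)\<^sup>2 * \<sigma>\<^sup>2 / 2))"
    by (simp add: exp_sum I prod_ennreal)
  also have "(\<Sum>i\<in>I. (w i)\<^sup>2 * \<sigma>\<^sup>2 / 2) = \<sigma>\<^sup>2 * (\<Sum>i\<in>I. (w i)\<^sup>2) / 2"
    by (simp add: sum_distrib_left sum_divide_distrib mult.commute)
  finally show ?thesis .
qed

lemma gauss_vec_exp_square:
  assumes "finite I"
  shows "(\<integral>\<^sup>+z. ennreal (exp ((\<Sum>i\<in>I. (z i)\<^sup>2) / 4)) \<partial>gauss_vec I 1) = ennreal (sqrt 2 ^ card I)"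
proof -
  interpret product_sigma_finite "\<lambda>_::nat. gauss 1"
    by (rule product_sigma_finite_gauss) simp
  have "(\<integral>\<^sup>+z. ennreal (exp ((\<Sum>i\<in>I. (z i)\<^sup>2) / 4)) \<partial>gauss_vec I 1)
      = (\<integral>\<^sup>+z. (\<Prod>i\<in>I. ennreal (exp ((z i)\<^sup>2 / 4))) \<partial>gauss_vec I 1)"
    by (simp add: exp_sum assms prod_ennreal sum_divide_distrib)
  also have "\<dots> = (\<Prod>i\<in>I. ennreal (sqrt 2))"
    using assms by (subst product_nn_integral_prod) (simp_all add: gauss_exp_square)
  finally show ?thesis
    by (simp add: ennreal_power)
qed

lemma dot_measurable_gauss_vec:
  assumes "n \<le> T"
  shows "(\<lambda>\<eta>. dot n \<eta> w) \<in> borel_measurable (gauss_vec {1..T} \<sigma>)"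
  unfolding dot_def
proof (intro borel_measurable_sum borel_measurable_times borel_measurable_const)
  fix i assume "i \<in> {1..n}"
  then have "(\<lambda>\<eta>. \<eta> i) \<in> gauss_vec {1..T} \<sigma> \<rightarrow>\<^sub>M gauss \<sigma>"
    using assms by (intro measurable_component_singleton) auto
  then show "(\<lambda>\<eta>. \<eta> i) \<in> borel_measurable (gauss_vec {1..T} \<sigma>)"
    by (simp add: measurable_cong_sets[OF refl, of "gauss \<sigma>" borel])
qed

text \<open>
  \<open>exp (g\<^sup>2 / (4 * \<sigma>\<^sup>2))\<close> is the moment generating function of an independent standard normal \<open>z\<close>
  at \<open>g / (sqrt 2 * \<sigma>)\<close>. Integrating over \<open>\<eta>\<close> before \<open>z\<close> replaces the rotation invariance of
  the normal distribution.
\<close>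

lemma gauss_vec_chi_square_mgf:
  assumes \<sigma>: "\<sigma> > 0" and n: "n \<le> T" and e: "orthonormal n k e"
  shows "(\<integral>\<^sup>+\<eta>. ennreal (exp ((\<Sum>l<k. (dot n \<eta> (e l))\<^sup>2) / (4 * \<sigma>\<^sup>2))) \<partial>gauss_vec {1..T} \<sigma>)
    = ennreal (sqrt 2 ^ k)"
proof -
  let ?N = "gauss_vec {1..T} \<sigma>" and ?Z = "gauss_vec {..<k} 1"
  \<comment> \<open>Half of \<open>\<rho>\<^sup>2\<close> is the wanted coefficient
    \<open>1 / (4 * \<sigma>\<^sup>2)\<close>.\<close>
  define \<rho> where "\<rho> = 1 / (sqrt 2 * \<sigma>)"
  have \<rho>: "\<rho>\<^sup>2 = 1 / (2 * \<sigma>\<^sup>2)"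
    using \<sigma> by (simp add: \<rho>_def power_divide power_mult_distrib)
  interpret N: prob_space ?N
    by (rule prob_space_gauss_vec[OF \<sigma>])
  interpret Z: prob_space ?Z
    by (rule prob_space_gauss_vec) simp
  interpret pair_sigma_finite ?N ?Z ..
  have meas: "(\<lambda>(\<eta>, z). ennreal (exp (\<Sum>l<k. (\<rho> * dot n \<eta> (e l)) * z l))) \<in> borel_measurable (?N \<Otimes>\<^sub>M ?Z)"
  proof -
    have z: "(\<lambda>p. snd p l) \<in> borel_measurable (?N \<Otimes>\<^sub>M ?Z)" if "l < k" for l
    proof -
      have "(\<lambda>z. z l) \<in> ?Z \<rightarrow>\<^sub>M gauss 1"
        using that by (intro measurable_component_singleton) auto
      then have "(\<lambda>z. z l) \<in> borel_measurable ?Z"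
        by (simp add: measurable_cong_sets[OF refl, of "gauss 1" borel])
      then show ?thesis
        by (rule measurable_compose[OF measurable_snd])
    qed
    have \<eta>: "(\<lambda>p. dot n (fst p) (e l)) \<in> borel_measurable (?N \<Otimes>\<^sub>M ?Z)" for l
      by (rule measurable_compose[OF measurable_fst dot_measurable_gauss_vec[OF n]])
    have "(\<lambda>p. \<Sum>l<k. (\<rho> * dot n (fst p) (e l)) * snd p l) \<in> borel_measurable (?N \<Otimes>\<^sub>M ?Z)"
      by (intro borel_measurable_sum borel_measurable_times borel_measurable_const \<eta> z) auto
    then have "(\<lambda>p. ennreal (exp (\<Sum>l<k. (\<rho> * dot n (fst p) (e l)) * snd p l))) \<in> borel_measurable (?N \<Otimes>\<^sub>M ?Z)"
      by measurable
    then show ?thesis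
      by (simp add: case_prod_unfold)
  qed
  have "(\<integral>\<^sup>+\<eta>. ennreal (exp ((\<Sum>l<k. (dot n \<eta> (e l))\<^sup>2) / (4 * \<sigma>\<^sup>2))) \<partial>?N)
      = (\<integral>\<^sup>+\<eta>. (\<integral>\<^sup>+z. ennreal (exp (\<Sum>l<k. (\<rho> * dot n \<eta> (e l)) * z l)) \<partial>?Z) \<partial>?N)"
    by (subst gauss_vec_mgf)
      (simp_all add: power_mult_distrib \<rho> sum_divide_distrib[symmetric] mult.commute)
  also have "\<dots> = (\<integral>\<^sup>+z. (\<integral>\<^sup>+\<eta>. ennreal (exp (\<Sum>l<k. (\<rho> * dot n \<eta> (e l)) * z l)) \<partial>?N) \<partial>?Z)"
    using Fubini'[OF meas] by simp
  also have "\<dots> = (\<integral>\<^sup>+z. ennreal (exp ((\<Sum>l<k. (z l)\<^sup>2) / 4)) \<partial>?Z)"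
  proof (rule nn_integral_cong)
    fix z :: rvec
    define v where "v = (\<lambda>t. \<Sum>l<k. z l * e l t)"
    \<comment> \<open>The noise has \<open>T\<close> coordinates and only the first \<open>n\<close>
      meet the design; padding with zeros lets \<open>gauss_vec_mgf\<close> act on
      \<open>{1..T}\<close>. Orthonormality makes the squared length of \<open>w\<close> equal to
      \<open>\<rho>\<^sup>2\<close> times that of \<open>z\<close>.\<close>
    define w where "w = (\<lambda>t. if t \<le> n then \<rho> * v t else 0)"
    have "(\<Sum>l<k. (\<rho> * dot n \<eta> (e l)) * z l) = (\<Sum>t=1..T. w t * \<eta> t)" for \<eta>
    proof -
      have "(\<Sum>l<k. (\<rho> * dot n \<eta> (e l)) * z l) = \<rho> * dot n \<eta> v"
        unfolding v_def dot_sum_right by (simp add: sum_distrib_left mult_ac)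
      also have "\<dots> = (\<Sum>t=1..n. w t * \<eta> t)"
        by (simp add: dot_def sum_distrib_left w_def mult_ac)
      also have "\<dots> = (\<Sum>t=1..T. w t * \<eta> t)"
        using n by (intro sum.mono_neutral_left) (auto simp: w_def)
      finally show ?thesis .
    qed
    moreover have "(\<Sum>t=1..T. (w t)\<^sup>2) = \<rho>\<^sup>2 * (\<Sum>l<k. (z l)\<^sup>2)"
    proof -
      have "(\<Sum>t=1..T. (w t)\<^sup>2) = (\<Sum>t=1..n. (w t)\<^sup>2)"
        using n by (intro sum.mono_neutral_right) (auto simp: w_def)
      also have "\<dots> = \<rho>\<^sup>2 * dot n v v"
        by (simp add: dot_def sum_distrib_left w_def power2_eq_square mult_ac)
      finally show ?thesis
        unfolding v_def orthonormal_dot_self_combination[OF e] .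
    qed
    ultimately show "(\<integral>\<^sup>+\<eta>. ennreal (exp (\<Sum>l<k. (\<rho> * dot n \<eta> (e l)) * z l)) \<partial>?N)
        = ennreal (exp ((\<Sum>l<k. (z l)\<^sup>2) / 4))"
      using \<sigma> by (simp add: gauss_vec_mgf \<rho>)
  qed
  also have "\<dots> = ennreal (sqrt 2 ^ k)"
    by (simp add: gauss_vec_exp_square)
  finally show ?thesis .
qed

text \<open>Expanding \<open>v\<close> in an orthonormal basis and completing the square in each
  coefficient bounds the expression, for all \<open>v\<close> at once, by the squared length
  \<open>g\<close> of the projection of \<open>\<eta>\<close>. Markov's inequality for
  \<open>exp (g \<eta> / (4 * \<sigma>\<^sup>2))\<close> then gives one event that serves the whole
  subspace.\<close>

lemma gauss_vec_gen_space_tail: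
  assumes \<sigma>: "\<sigma> > 0" and n: "n \<le> T"
  obtains A where "A \<in> sets (gauss_vec {1..T} \<sigma>)"
    and "emeasure (gauss_vec {1..T} \<sigma>) A \<le> ennreal (exp (- s / (4 * \<sigma>\<^sup>2)) * sqrt 2 ^ r)"
    and "\<And>\<eta> v. \<eta> \<in> space (gauss_vec {1..T} \<sigma>) - A \<Longrightarrow> v \<in> gen_space n r f
      \<Longrightarrow> 2 * dot n \<eta> v - dot n v v \<le> s"
proof -
  let ?N = "gauss_vec {1..T} \<sigma>"
  obtain k e where k: "k \<le> r" and e: "orthonormal n k e" and S: "gen_space n r f = gen_space n k e"
    by (rule gen_space_orthonormal)
  define g where "g = (\<lambda>\<eta>. \<Sum>l<k. (dot n \<eta> (e l))\<^sup>2)"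
  define u where "u = (\<lambda>\<eta>. ennreal (exp (g \<eta> / (4 * \<sigma>\<^sup>2))))"
  define c where "c = ennreal (exp (- s / (4 * \<sigma>\<^sup>2)))"
  have g: "g \<in> borel_measurable ?N"
    unfolding g_def by (intro borel_measurable_sum borel_measurable_power dot_measurable_gauss_vec n)
  then have u: "u \<in> borel_measurable ?N"
    unfolding u_def by measurable
  have le: "2 * dot n \<eta> v - dot n v v \<le> g \<eta>" if v: "v \<in> gen_space n k e" for \<eta> v
  proof -
    obtain a where a: "\<forall>i\<in>{1..n}. v i = (\<Sum>l<k. a l * e l i)"
      using v by (rule gen_spaceE)
    have "dot n v v = dot n (\<lambda>i. \<Sum>l<k. a l * e l i) (\<lambda>i. \<Sum>l<k. a l * e l i)"
      using a by (intro dot_cong) auto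
    then have "2 * dot n \<eta> v - dot n v v = (\<Sum>l<k. 2 * (a l * dot n \<eta> (e l)) - (a l)\<^sup>2)"
      unfolding orthonormal_dot_self_combination[OF e] dot_combination_right[OF a]
      by (simp add: sum_subtractf sum_distrib_left)
    also have "\<dots> \<le> g \<eta>"
      unfolding g_def
    proof (rule sum_mono)
      fix l
      show "2 * (a l * dot n \<eta> (e l)) - (a l)\<^sup>2 \<le> (dot n \<eta> (e l))\<^sup>2"
        using zero_le_power2[of "a l - dot n \<eta> (e l)"] by (simp add: power2_diff)
    qed
    finally show ?thesis .
  qed
  define A where "A = {\<eta> \<in> space ?N. 1 \<le> c * u \<eta>}"
  have "A \<in> sets ?N"
    unfolding A_def using u by measurable
  moreover have "emeasure ?N A \<le> ennreal (exp (- s / (4 * \<sigma>\<^sup>2)) * sqrt 2 ^ r)"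
  proof -
    have "emeasure ?N A \<le> c * (\<integral>\<^sup>+\<eta>. u \<eta> * indicator (space ?N) \<eta> \<partial>?N)"
      using nn_integral_Markov_inequality[of u "space ?N" ?N c] u by (simp add: A_def)
    also have "(\<integral>\<^sup>+\<eta>. u \<eta> * indicator (space ?N) \<eta> \<partial>?N) = (\<integral>\<^sup>+\<eta>. u \<eta> \<partial>?N)"
      by (intro nn_integral_cong) simp
    also have "\<dots> = ennreal (sqrt 2 ^ k)"
      unfolding u_def g_def by (rule gauss_vec_chi_square_mgf[OF \<sigma> n e])
    also have "c * \<dots> \<le> c * ennreal (sqrt 2 ^ r)"
      using k by (intro mult_left_mono ennreal_leI power_increasing) auto
    also have "\<dots> = ennreal (exp (- s / (4 * \<sigma>\<^sup>2)) * sqrt 2 ^ r)"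
      by (simp add: c_def ennreal_mult)
    finally show ?thesis .
  qed
  moreover have "2 * dot n \<eta> v - dot n v v \<le> s"
    if \<eta>: "\<eta> \<in> space ?N - A" and v: "v \<in> gen_space n r f" for \<eta> v
  proof (rule ccontr)
    assume "\<not> ?thesis"
    then have "s \<le> g \<eta>"
      using le[of v \<eta>] v S by simp
    then have "0 \<le> - s / (4 * \<sigma>\<^sup>2) + g \<eta> / (4 * \<sigma>\<^sup>2)"
      using \<sigma> by (simp add: field_simps)
    then have "1 \<le> exp (- s / (4 * \<sigma>\<^sup>2)) * exp (g \<eta> / (4 * \<sigma>\<^sup>2))"
      unfolding exp_add[symmetric] by (simp only: one_le_exp_iff)
    then have "1 \<le> c * u \<eta>"
      by (simp add: c_def u_def ennreal_mult[symmetric] del: exp_le_one_iff)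
    with \<eta> show False
      by (simp add: A_def)
  qed
  ultimately show ?thesis
    by (rule that)
qed

section \<open>The smallest eigenvalue as a Rayleigh quotient\<close>

text \<open>The first order condition at a minimum; it shows below that a minimiser of the Rayleigh
  quotient is an eigenvector.\<close>

lemma nonneg_quadratic_imp_linear_coeff_0:
  fixes a b :: real
  assumes "\<And>t. 0 \<le> 2 * t * a + t\<^sup>2 * b"
  shows "a = 0"
proof (rule ccontr)
  assume a: "a \<noteq> 0"
  \<comment> \<open>At \<open>t = - a / c\<close> the quadratic equals
    \<open>- (a\<^sup>2 / c) * (2 - b / c)\<close>, which is negative for any positive
    \<open>c\<close> above \<open>b\<close>.\<close>
  define c where "c = \<bar>b\<bar> + 1"
  have c: "c > 0" "b < c" by (auto simp: c_def)
  have "2 * (- a / c) * a + (- a / c)\<^sup>2 * b = - (a\<^sup>2 / c) * (2 - b / c)"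
    using c by (simp add: field_simps power2_eq_square)
  moreover have "a\<^sup>2 / c > 0" "2 - b / c > 0"
    using a c by (auto simp: field_simps)
  ultimately have "2 * (- a / c) * a + (- a / c)\<^sup>2 * b < 0"
    by (simp only: mult_minus_left neg_less_0_iff_less mult_pos_pos)
  with assms[of "- a / c"] show False by linarith
qed

text \<open>\<open>lambda_min\<close> is defined through the spectrum, so an actual eigenvalue is
  needed that bounds the form from below. The form attains its minimum on the unit sphere by
  compactness, and the first order condition makes the minimiser an eigenvector with that minimum as
  eigenvalue.\<close>

lemma lambda_min_le_quadratic_form:
  fixes m :: "nat \<Rightarrow> nat \<Rightarrow> real"
  assumes d: "d \<ge> 1" and sym: "\<And>i j. m i j = m j i"
  defines "A \<equiv> mat d d (\<lambda>(i, j). m (Suc i) (Suc j))"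
  shows "lambda_min A * dot d w w \<le> (\<Sum>i=1..d. \<Sum>j=1..d. m i j * (w i * w j))"
proof -
  define B where "B = (\<lambda>v w. \<Sum>i=1..d. \<Sum>j=1..d. m i j * (v i * w j))"
  \<comment> \<open>With free coordinates outside \<open>{1..d}\<close> the set
    \<open>dot d v v = 1\<close> would not be compact. Pinning them to 0 makes \<open>box\<close> a
    product of compact sets, in which the sphere is closed.\<close>
  define box where "box = PiE UNIV (\<lambda>i. if i \<in> {1..d} then {-1..1} else {0::real})"
  define sph where "sph = box \<inter> {v. dot d v v = 1}"
  have coord: "continuous_on UNIV (\<lambda>v::rvec. v i)" for i
    by (rule continuous_on_product_coordinates)
  have dot_cont: "continuous_on UNIV (\<lambda>v. dot d v v)"
    unfolding dot_def by (intro continuous_intros coord)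
  have B_cont: "continuous_on UNIV (\<lambda>v. B v v)"
    unfolding B_def by (intro continuous_intros coord)
  have "compactin (product_topology (\<lambda>_. euclidean) UNIV) box"
    unfolding box_def compactin_PiE by (auto simp: compactin_euclidean_iff)
  then have "compact box"
    by (simp add: euclidean_product_topology compactin_euclidean_iff)
  moreover have "closed {v. dot d v v = 1}"
    by (intro closed_Collect_eq dot_cont continuous_on_const)
  ultimately have compact: "compact sph"
    unfolding sph_def by (rule compact_Int_closed)
  have norm_in: "\<exists>c>0. (\<lambda>i. if i \<in> {1..d} then c * w i else 0) \<in> sph \<and> c\<^sup>2 * dot d w w = 1"
    if w: "dot d w w \<noteq> 0" for w
  proof -
    define c where "c = 1 / sqrt (dot d w w)"
    have pos: "dot d w w > 0"
      using w dot_self_nonneg[of d w] by linarith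
    then have c: "c > 0" "c\<^sup>2 * dot d w w = 1"
      by (simp_all add: c_def power_divide)
    let ?v = "\<lambda>i. if i \<in> {1..d} then c * w i else 0"
    have 1: "dot d ?v ?v = 1"
    proof -
      have "dot d ?v ?v = c\<^sup>2 * dot d w w"
        by (simp add: dot_def sum_distrib_left power2_eq_square mult_ac)
      then show ?thesis using c by simp
    qed
    have "?v i \<in> {-1..1}" if i: "i \<in> {1..d}" for i
    proof -
      have "(?v i)\<^sup>2 \<le> (\<Sum>i=1..d. (?v i)\<^sup>2)"
        using i by (intro member_le_sum) auto
      also have "\<dots> = 1"
        using 1 by (simp only: dot_def power2_eq_square)
      finally have "\<bar>?v i\<bar> \<le> 1"
        by (simp only: abs_square_le_1)
      moreover have "\<bar>y\<bar> \<le> 1 \<Longrightarrow> y \<in> {-1..1}" for y :: real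
        by auto
      ultimately show ?thesis
        by blast
    qed
    then have "?v \<in> box"
      unfolding box_def by auto
    with 1 c show ?thesis
      unfolding sph_def by (intro exI[of _ c]) simp
  qed
  have "dot d (\<lambda>_. 1) (\<lambda>_. 1) \<noteq> 0"
    using d by (simp add: dot_def)
  from norm_in[OF this] have "sph \<noteq> {}" by blast
  then obtain v where v: "v \<in> sph" and min: "\<And>w. w \<in> sph \<Longrightarrow> B v v \<le> B w w"
    using continuous_attains_inf[OF compact, of "\<lambda>v. B v v"] continuous_on_subset[OF B_cont]
    by (metis top_greatest)
  define \<mu> where "\<mu> = B v v"
  have v1: "dot d v v = 1"
    using v by (simp add: sph_def)
  have lower: "\<mu> * dot d w w \<le> B w w" for w
  proof (cases "dot d w w = 0")
    case True
    then have "B w w = 0"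
      unfolding B_def dot_self_eq_0 by simp
    with True show ?thesis by simp
  next
    case False
    from norm_in[OF this] obtain c where c: "c > 0" "c\<^sup>2 * dot d w w = 1"
      and s: "(\<lambda>i. if i \<in> {1..d} then c * w i else 0) \<in> sph" by blast
    have "\<mu> \<le> c\<^sup>2 * B w w"
      using min[OF s] by (simp add: \<mu>_def B_def sum_distrib_left power2_eq_square mult_ac)
    then have "\<mu> * dot d w w \<le> (c\<^sup>2 * B w w) * dot d w w"
      by (intro mult_right_mono) auto
    also have "\<dots> = (c\<^sup>2 * dot d w w) * B w w"
      by (simp only: mult_ac)
    finally show ?thesis
      unfolding c(2) by simp
  qed
  have eig: "(\<Sum>j=1..d. m i j * v j) = \<mu> * v i" if i: "i \<in> {1..d}" for i
  proof -
    \<comment> \<open>Varying the minimiser along the coordinate direction \<open>h\<close> reads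
      off one row of the eigenvalue equation.\<close>
    define h :: rvec where "h = (\<lambda>k. if k = i then 1 else 0)"
    have Bvh: "B v h = (\<Sum>j=1..d. m i j * v j)"
    proof -
      have "B v h = (\<Sum>k=1..d. m k i * v k)"
        unfolding B_def h_def using i by (intro sum.cong) (auto simp: if_distrib cong: if_cong)
      then show ?thesis
        using sym[of _ i] by simp
    qed
    have Bhv: "B h v = (\<Sum>j=1..d. m i j * v j)"
    proof -
      have "B h v = (\<Sum>k=1..d. if k = i then (\<Sum>j=1..d. m k j * v j) else 0)"
        unfolding B_def h_def by (intro sum.cong) auto
      then show ?thesis
        using i by simp
    qed
    have dvh: "dot d v h = v i"
      using i by (simp add: dot_def h_def if_distrib cong: if_cong)
    have "0 \<le> 2 * t * ((\<Sum>j=1..d. m i j * v j) - \<mu> * v i) + t\<^sup>2 * (B h h - \<mu> * dot d h h)" for t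
    proof -
      have "B (\<lambda>k. v k + t * h k) (\<lambda>k. v k + t * h k)
          = B v v + t * B v h + t * B h v + t\<^sup>2 * B h h"
        unfolding B_def sum_distrib_left sum.distrib[symmetric]
        by (intro sum.cong refl) (simp add: algebra_simps power2_eq_square)
      moreover have "dot d (\<lambda>k. v k + t * h k) (\<lambda>k. v k + t * h k)
          = dot d v v + 2 * t * dot d v h + t\<^sup>2 * dot d h h"
        unfolding dot_def sum_distrib_left sum.distrib[symmetric]
        by (intro sum.cong refl) (simp add: algebra_simps power2_eq_square)
      ultimately show ?thesis
        using lower[of "\<lambda>k. v k + t * h k"]
        by (simp add: v1 dvh Bvh Bhv \<mu>_def[symmetric] algebra_simps)
    qed
    from nonneg_quadratic_imp_linear_coeff_0[OF this] show ?thesis by simp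
  qed
  have A: "A \<in> carrier_mat d d"
    by (simp add: A_def)
  define u where "u = vec d (\<lambda>i. v (Suc i))"
  have "eigenvector A u \<mu>"
    unfolding eigenvector_def
  proof (intro conjI)
    show "u \<in> carrier_vec (dim_row A)"
      by (simp add: u_def A_def)
    show "u \<noteq> 0\<^sub>v (dim_row A)"
    proof
      assume "u = 0\<^sub>v (dim_row A)"
      then have "v (Suc i) = 0" if "i < d" for i
        using that by (auto simp: u_def A_def vec_eq_iff)
      then have "v i = 0" if "i \<in> {1..d}" for i
        using that by (cases i) auto
      then have "dot d v v = 0"
        by (simp add: dot_self_eq_0)
      with v1 show False by simp
    qed
    show "A *\<^sub>v u = \<mu> \<cdot>\<^sub>v u"
    proof (rule eq_vecI)
      fix i assume "i < dim_vec (\<mu> \<cdot>\<^sub>v u)"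
      then have i: "i < d" by (simp add: u_def)
      have "(A *\<^sub>v u) $ i = (\<Sum>j<d. m (Suc i) (Suc j) * v (Suc j))"
        using i by (simp add: A_def u_def scalar_prod_def lessThan_atLeast0)
      also have "\<dots> = (\<Sum>j=1..d. m (Suc i) j * v j)"
        by (simp add: sum.atLeast1_atMost_eq lessThan_atLeast0)
      also have "\<dots> = \<mu> * v (Suc i)"
        using i by (intro eig) auto
      finally show "(A *\<^sub>v u) $ i = (\<mu> \<cdot>\<^sub>v u) $ i"
        using i by (simp add: u_def)
    qed (simp add: A_def u_def)
  qed
  then have "\<mu> \<in> spectrum A"
    by (auto simp: spectrum_def eigenvalue_def)
  then have "lambda_min A \<le> \<mu>"
    unfolding lambda_min_def using card_finite_spectrum(1)[OF A] by (intro Min_le)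
  then have "lambda_min A * dot d w w \<le> \<mu> * dot d w w"
    by (intro mult_right_mono) auto
  with lower[of w] show ?thesis
    unfolding B_def by linarith
qed

section \<open>Concentration of the empirical second moment\<close>

text \<open>The linear functionals \<open>x i\<close> and \<open>- x i\<close> attain their maxima
  over \<open>X\<close>. Hoeffding's inequality needs such a bound on whole arms, whereas
  \<open>Kx\<close> controls only their projections onto joined models.\<close>

lemma arms_bounded:
  assumes "\<forall>\<theta>\<in>vecs d. \<exists>x. is_arg_max (\<lambda>x. dot d x \<theta>) (\<lambda>x. x \<in> X) x"
  obtains b where "b > 0" "\<And>x i. x \<in> X \<Longrightarrow> i \<in> {1..d} \<Longrightarrow> \<bar>x i\<bar> \<le> b"
proof -
  have "\<exists>b. \<forall>x\<in>X. \<bar>x i\<bar> \<le> b" if i: "i \<in> {1..d}" for i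
  proof -
    have "\<exists>b. \<forall>x\<in>X. c * x i \<le> b" for c :: real
    proof -
      define \<theta> where "\<theta> = (\<lambda>k\<in>{1..d}. if k = i then c else 0)"
      have "dot d x \<theta> = c * x i" for x
      proof -
        have "dot d x \<theta> = (\<Sum>k=1..d. if k = i then c * x k else 0)"
          unfolding dot_def \<theta>_def by (intro sum.cong) auto
        then show ?thesis using i by simp
      qed
      moreover obtain y where "is_arg_max (\<lambda>x. dot d x \<theta>) (\<lambda>x. x \<in> X) y"
        using assms by (metis \<theta>_def vecs_def restrict_PiE_iff UNIV_I)
      ultimately show ?thesis
        by (auto simp: is_arg_max_linorder)
    qed
    from this[of 1] this[of "-1"] obtain b b' where "\<forall>x\<in>X. x i \<le> b" "\<forall>x\<in>X. - x i \<le> b'"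
      by auto
    then have "\<forall>x\<in>X. \<bar>x i\<bar> \<le> max b b'"
      by (auto intro!: abs_leI intro: max.coboundedI1 max.coboundedI2)
    then show ?thesis by blast
  qed
  then obtain b where b: "\<And>i x. i \<in> {1..d} \<Longrightarrow> x \<in> X \<Longrightarrow> \<bar>x i\<bar> \<le> b i"
    by metis
  show ?thesis
  proof (rule that[of "1 + (\<Sum>i=1..d. \<bar>b i\<bar>)"])
    show "1 + (\<Sum>i=1..d. \<bar>b i\<bar>) > 0"
      by (simp add: add_pos_nonneg sum_nonneg)
    fix x i assume x: "x \<in> X" and i: "i \<in> {1..d}"
    have "\<bar>x i\<bar> \<le> \<bar>b i\<bar>"
      using b[OF i x] by linarith
    also have "\<dots> \<le> (\<Sum>i=1..d. \<bar>b i\<bar>)"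
      using i by (intro member_le_sum) auto
    finally show "\<bar>x i\<bar> \<le> 1 + (\<Sum>i=1..d. \<bar>b i\<bar>)"
      by simp
  qed
qed

lemma space_arm_dist:
  assumes "X \<subseteq> vecs d" "sets \<nu> = sets (arm_space d X)"
  shows "space \<nu> = X"
  using assms(1) sets_eq_imp_space_eq[OF assms(2)]
  by (auto simp: arm_space_def borel_vec_def vecs_def space_restrict_space space_PiM)

lemma coord_measurable_arm_dist:
  assumes "sets \<nu> = sets (arm_space d X)" "i \<in> {1..d}"
  shows "(\<lambda>y. y i) \<in> borel_measurable \<nu>"
proof -
  have "(\<lambda>y. y i) \<in> borel_measurable (arm_space d X)"
    unfolding arm_space_def borel_vec_def using assms(2)
    by (intro measurable_restrict_space1 measurable_component_singleton)
  then show ?thesis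
    using measurable_cong_sets[OF assms(1) refl] by blast
qed

text \<open>Hoeffding's exponential tail is weakened to the rate \<open>1 / n\<close> by
  \<open>exp (- y) \<le> 1 / y\<close>. This is enough: for large \<open>T\<close> the resulting
  cost \<open>T * \<kappa> / n\<close> is at most \<open>n\<close>.\<close>

lemma iid_sum_concentration:
  fixes f :: "'a \<Rightarrow> real"
  assumes \<nu>: "prob_space \<nu>" and f: "f \<in> borel_measurable \<nu>"
    and b: "b > 0" "\<And>y. y \<in> space \<nu> \<Longrightarrow> \<bar>f y\<bar> \<le> b" and n: "n \<ge> (1::nat)" and \<epsilon>: "\<epsilon> > 0"
  defines "P \<equiv> Pi\<^sub>M {1..n} (\<lambda>_. \<nu>)"
  shows "measure P {x \<in> space P. real n * \<epsilon> \<le> \<bar>(\<Sum>t=1..n. f (x t)) - real n * (\<integral>y. f y \<partial>\<nu>)\<bar>}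
    \<le> 4 * b\<^sup>2 / (real n * \<epsilon>\<^sup>2)"
proof -
  interpret P: prob_space P
    unfolding P_def using \<nu> by (intro prob_space_PiM)
  have comp: "(\<lambda>x. x t) \<in> P \<rightarrow>\<^sub>M \<nu>" if "t \<in> {1..n}" for t
    unfolding P_def using that by (intro measurable_component_singleton)
  have distr: "distr P \<nu> (\<lambda>x. x t) = \<nu>" if "t \<in> {1..n}" for t
    unfolding P_def using \<nu> that by (intro distr_PiM_component)
  \<comment> \<open>Independence is read off from the laws: the joint law of the coordinates is
    \<open>P\<close> itself, which is the product of its marginals.\<close>
  have "P.indep_vars (\<lambda>_. \<nu>) (\<lambda>t x. x t) {1..n}"
  proof (subst P.indep_vars_iff_distr_eq_PiM')
    have "distr P (Pi\<^sub>M {1..n} (\<lambda>_. \<nu>)) (\<lambda>x. \<lambda>t\<in>{1..n}. x t) = distr P P (\<lambda>x. x)"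
      by (intro distr_cong) (auto simp: P_def space_PiM PiE_restrict)
    also have "\<dots> = Pi\<^sub>M {1..n} (\<lambda>t. distr P \<nu> (\<lambda>x. x t))"
      unfolding distr_id P_def using distr[unfolded P_def] by (intro PiM_cong) auto
    finally show "distr P (Pi\<^sub>M {1..n} (\<lambda>_. \<nu>)) (\<lambda>x. \<lambda>t\<in>{1..n}. x t)
        = Pi\<^sub>M {1..n} (\<lambda>t. distr P \<nu> (\<lambda>x. x t))" .
  qed (use n comp in auto)
  then have indep: "P.indep_vars (\<lambda>_. borel) (\<lambda>t x. f (x t)) {1..n}"
    by (rule P.indep_vars_compose2) (rule f)
  have mean: "P.expectation (\<lambda>x. f (x t)) = (\<integral>y. f y \<partial>\<nu>)" if "t \<in> {1..n}" for t
    using integral_distr[OF comp[OF that] f] distr[OF that] by simp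
  interpret Hoeffding_ineq P "{1..n}" "\<lambda>t x. f (x t)" "\<lambda>_. - b" "\<lambda>_. b" "real n * (\<integral>y. f y \<partial>\<nu>)"
  proof unfold_locales
    fix t assume t: "t \<in> {1..n}"
    show "AE x in P. f (x t) \<in> {- b..b}"
    proof (rule AE_I2)
      fix x assume "x \<in> space P"
      then have "x t \<in> space \<nu>"
        using comp[OF t] by (rule measurable_space[rotated])
      from b(2)[OF this] show "f (x t) \<in> {- b..b}"
        by auto
    qed
  next
    show "real n * (\<integral>y. f y \<partial>\<nu>) \<equiv> \<Sum>t\<in>{1..n}. P.expectation (\<lambda>x. f (x t))"
      by (rule eq_reflection) (simp add: mean)
  qed (use indep in auto)
  have V: "(\<Sum>t\<in>{1..n}. (b - - b)\<^sup>2) = 4 * real n * b\<^sup>2"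
    by (simp add: power2_eq_square)
  have "measure P {x \<in> space P. real n * \<epsilon> \<le> \<bar>(\<Sum>t=1..n. f (x t)) - real n * (\<integral>y. f y \<partial>\<nu>)\<bar>}
      \<le> 2 * exp (-2 * (real n * \<epsilon>)\<^sup>2 / (\<Sum>t\<in>{1..n}. (b - - b)\<^sup>2))"
    using n b \<epsilon> by (intro Hoeffding_ineq_abs_ge) (simp_all add: V)
  also have "-2 * (real n * \<epsilon>)\<^sup>2 / (\<Sum>t\<in>{1..n}. (b - - b)\<^sup>2) = - (real n * \<epsilon>\<^sup>2 / (2 * b\<^sup>2))"
    unfolding V using n b by (simp add: field_simps power2_eq_square)
  also have "exp (- (real n * \<epsilon>\<^sup>2 / (2 * b\<^sup>2))) \<le> 1 / (real n * \<epsilon>\<^sup>2 / (2 * b\<^sup>2))"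
  proof -
    have "exp (- y) \<le> 1 / y" if y: "y > 0" for y :: real
    proof -
      have "y \<le> exp y"
        using exp_ge_add_one_self[of y] by linarith
      with y show ?thesis
        unfolding exp_minus inverse_eq_divide by (intro frac_le) auto
    qed
    moreover have "real n * \<epsilon>\<^sup>2 / (2 * b\<^sup>2) > 0"
      using n b(1) \<epsilon> by simp
    ultimately show ?thesis .
  qed
  finally show ?thesis
    by (simp add: field_simps)
qed

text \<open>Per sample, an entrywise error \<open>\<epsilon>\<close> changes the quadratic form by
  at most \<open>\<epsilon>\<close> times the squared l1 norm of \<open>v\<close>, and
  Cauchy-Schwarz turns this into \<open>\<epsilon> * d\<close> times the squared Euclidean
  norm.\<close>

lemma design_lower_bound_aux:
  fixes x :: "nat \<Rightarrow> rvec"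
  assumes C: "\<And>v. C * dot d v v \<le> (\<Sum>i=1..d. \<Sum>j=1..d. m i j * (v i * v j))"
    and close: "\<And>i j. i \<in> {1..d} \<Longrightarrow> j \<in> {1..d} \<Longrightarrow>
      \<bar>(\<Sum>t=1..n. x t i * x t j) - real n * m i j\<bar> \<le> real n * \<epsilon>"
    and \<epsilon>: "\<epsilon> \<ge> 0"
  shows "real n * (C - \<epsilon> * real d) * dot d v v \<le> (\<Sum>t=1..n. (dot d (x t) v)\<^sup>2)"
proof -
  define S where "S = (\<lambda>i j. \<Sum>t=1..n. x t i * x t j)"
  have "(\<Sum>t=1..n. (dot d (x t) v)\<^sup>2) = (\<Sum>t=1..n. \<Sum>i=1..d. \<Sum>j=1..d. x t i * x t j * (v i * v j))"
    by (simp add: dot_def power2_eq_square sum_product mult_ac)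
  also have "\<dots> = (\<Sum>i=1..d. \<Sum>j=1..d. S i j * (v i * v j))"
    unfolding S_def sum_distrib_right
    by (subst sum.swap) (intro sum.cong refl sum.swap)
  finally have eq: "(\<Sum>t=1..n. (dot d (x t) v)\<^sup>2) = (\<Sum>i=1..d. \<Sum>j=1..d. S i j * (v i * v j))" .
  have "(\<Sum>i=1..d. \<bar>v i\<bar>)\<^sup>2 \<le> (\<Sum>i=1..d. \<bar>v i\<bar>\<^sup>2) * card {1..d}"
    by (rule sum_squared_le_sum_of_squares)
  then have sq: "(\<Sum>i=1..d. \<bar>v i\<bar>)\<^sup>2 \<le> real d * dot d v v"
    by (simp add: dot_def power2_eq_square mult.commute)
  have "real n * (C * dot d v v) \<le> real n * (\<Sum>i=1..d. \<Sum>j=1..d. m i j * (v i * v j))"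
    by (intro mult_left_mono C) auto
  also have "\<dots> = (\<Sum>i=1..d. \<Sum>j=1..d. real n * m i j * (v i * v j))"
    by (simp add: sum_distrib_left mult.assoc)
  also have "\<dots> \<le> (\<Sum>i=1..d. \<Sum>j=1..d. S i j * (v i * v j) + real n * \<epsilon> * (\<bar>v i\<bar> * \<bar>v j\<bar>))"
  proof (intro sum_mono)
    fix i j assume ij: "i \<in> {1..d}" "j \<in> {1..d}"
    have "(real n * m i j - S i j) * (v i * v j) \<le> \<bar>real n * m i j - S i j\<bar> * (\<bar>v i\<bar> * \<bar>v j\<bar>)"
      by (simp add: abs_mult[symmetric])
    also have "\<dots> \<le> real n * \<epsilon> * (\<bar>v i\<bar> * \<bar>v j\<bar>)"
      using close[OF ij] by (intro mult_right_mono) (auto simp: S_def abs_minus_commute)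
    finally show "real n * m i j * (v i * v j) \<le> S i j * (v i * v j) + real n * \<epsilon> * (\<bar>v i\<bar> * \<bar>v j\<bar>)"
      by (simp add: left_diff_distrib)
  qed
  also have "\<dots> = (\<Sum>t=1..n. (dot d (x t) v)\<^sup>2) + real n * \<epsilon> * (\<Sum>i=1..d. \<bar>v i\<bar>)\<^sup>2"
    unfolding eq power2_eq_square[of "\<Sum>i=1..d. \<bar>v i\<bar>"] sum_product
    by (simp only: sum.distrib sum_distrib_left)
  also have "\<dots> \<le> (\<Sum>t=1..n. (dot d (x t) v)\<^sup>2) + real n * \<epsilon> * (real d * dot d v v)"
    using sq \<epsilon> by (intro add_left_mono mult_left_mono) auto
  finally show ?thesis
    by (simp add: algebra_simps)
qed

text \<open>A union bound over the \<open>d * d\<close> matrix entries controls all directions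
  \<open>v\<close> at once. \<kappa> does not depend on \<open>n\<close> but does depend on
  \<open>d\<close>, \<open>b\<close> and the eigenvalue, so it may enter the threshold on
  \<open>T\<close> and not the hidden constant.\<close>

lemma design_lower_bound:
  assumes d: "d \<ge> 1" and X: "X \<subseteq> vecs d" and \<nu>: "prob_space \<nu>" and sets: "sets \<nu> = sets (arm_space d X)"
    and b: "b > 0" "\<And>x i. x \<in> X \<Longrightarrow> i \<in> {1..d} \<Longrightarrow> \<bar>x i\<bar> \<le> b"
    and C: "lambda_min (second_moment d \<nu>) > 0"
  obtains \<kappa> where "\<kappa> > 0" "\<And>n. n \<ge> 1 \<Longrightarrow> \<exists>E\<in>sets (Pi\<^sub>M {1..n} (\<lambda>_. \<nu>)).
    measure (Pi\<^sub>M {1..n} (\<lambda>_. \<nu>)) E \<le> \<kappa> / real n \<and>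
    (\<forall>x\<in>space (Pi\<^sub>M {1..n} (\<lambda>_. \<nu>)) - E. \<forall>v.
      real n * (lambda_min (second_moment d \<nu>) / 2) * dot d v v \<le> (\<Sum>t=1..n. (dot d (x t) v)\<^sup>2))"
proof -
  define C where "C = lambda_min (second_moment d \<nu>)"
  define m where "m = (\<lambda>i j. \<integral>y. y i * y j \<partial>\<nu>)"
  \<comment> \<open>The loss \<open>\<epsilon> * d\<close> is then exactly half of
    \<open>C\<close>.\<close>
  define \<epsilon> where "\<epsilon> = C / (2 * real d)"
  have \<epsilon>: "\<epsilon> > 0"
    using d C by (simp add: \<epsilon>_def C_def)
  have quad: "C * dot d v v \<le> (\<Sum>i=1..d. \<Sum>j=1..d. m i j * (v i * v j))" for v
    using lambda_min_le_quadratic_form[OF d, of m v]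
    by (simp add: C_def second_moment_def m_def mult.commute)
  note coord = coord_measurable_arm_dist[OF sets]
  define \<kappa> where "\<kappa> = (\<Sum>i=1..d. \<Sum>j=1..d. 4 * (b * b)\<^sup>2 / \<epsilon>\<^sup>2)"
  show ?thesis
  proof (rule that[of \<kappa>])
    show "\<kappa> > 0"
      unfolding \<kappa>_def using b \<epsilon> d by (intro sum_pos) auto
    fix n :: nat assume n: "n \<ge> 1"
    let ?P = "Pi\<^sub>M {1..n} (\<lambda>_. \<nu>)"
    interpret P: prob_space ?P
      using \<nu> by (intro prob_space_PiM)
    define E where "E = (\<lambda>i j. {x \<in> space ?P.
      real n * \<epsilon> \<le> \<bar>(\<Sum>t=1..n. x t i * x t j) - real n * m i j\<bar>})"
    have E: "E i j \<in> sets ?P \<and> measure ?P (E i j) \<le> 4 * (b * b)\<^sup>2 / \<epsilon>\<^sup>2 / real n"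
      if i: "i \<in> {1..d}" and j: "j \<in> {1..d}" for i j
    proof
      have f: "(\<lambda>y. y i * y j) \<in> borel_measurable \<nu>"
        by (intro borel_measurable_times coord i j)
      have "(\<lambda>x. x t i * x t j) \<in> borel_measurable ?P" if "t \<in> {1..n}" for t
        by (rule measurable_compose[OF measurable_component_singleton[OF that] f])
      then have "(\<lambda>x. \<Sum>t=1..n. x t i * x t j) \<in> borel_measurable ?P"
        by (intro borel_measurable_sum)
      then show "E i j \<in> sets ?P"
        unfolding E_def by measurable
      have bd: "\<bar>y i * y j\<bar> \<le> b * b" if "y \<in> space \<nu>" for y
        unfolding abs_mult using that b i j space_arm_dist[OF X sets] by (intro mult_mono) auto
      have "measure ?P (E i j) \<le> 4 * (b * b)\<^sup>2 / (real n * \<epsilon>\<^sup>2)"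
        unfolding E_def m_def using b(1) by (intro iid_sum_concentration \<nu> f bd n \<epsilon>) auto
      then show "measure ?P (E i j) \<le> 4 * (b * b)\<^sup>2 / \<epsilon>\<^sup>2 / real n"
        by (simp add: mult.commute)
    qed
    define B where "B = (\<Union>i\<in>{1..d}. \<Union>j\<in>{1..d}. E i j)"
    have "B \<in> sets ?P"
      unfolding B_def using E by (intro sets.finite_UN) auto
    moreover have "measure ?P B \<le> \<kappa> / real n"
    proof -
      have "measure ?P B \<le> (\<Sum>i=1..d. measure ?P (\<Union>j\<in>{1..d}. E i j))"
        unfolding B_def using E by (intro P.finite_measure_subadditive_finite) (auto intro!: sets.finite_UN)
      also have "\<dots> \<le> (\<Sum>i=1..d. \<Sum>j=1..d. measure ?P (E i j))"
        using E by (intro sum_mono P.finite_measure_subadditive_finite) auto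
      also have "\<dots> \<le> (\<Sum>i=1..d. \<Sum>j=1..d. 4 * (b * b)\<^sup>2 / \<epsilon>\<^sup>2 / real n)"
        using E by (intro sum_mono) blast
      also have "\<dots> = \<kappa> / real n"
        by (simp add: \<kappa>_def sum_divide_distrib)
      finally show ?thesis .
    qed
    moreover have "real n * (C / 2) * dot d v v \<le> (\<Sum>t=1..n. (dot d (x t) v)\<^sup>2)"
      if x: "x \<in> space ?P - B" for x v
    proof -
      have "\<bar>(\<Sum>t=1..n. x t i * x t j) - real n * m i j\<bar> \<le> real n * \<epsilon>"
        if "i \<in> {1..d}" "j \<in> {1..d}" for i j
      proof -
        have "x \<notin> E i j"
          using x that unfolding B_def by blast
        with x show ?thesis
          by (simp add: E_def)
      qed
      from design_lower_bound_aux[OF quad this, of v] \<epsilon>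
      have "real n * (C - \<epsilon> * real d) * dot d v v \<le> (\<Sum>t=1..n. (dot d (x t) v)\<^sup>2)"
        by simp
      moreover have "C - \<epsilon> * real d = C / 2"
        using d by (simp add: \<epsilon>_def)
      ultimately show ?thesis by simp
    qed
    ultimately show "\<exists>E\<in>sets ?P. measure ?P E \<le> \<kappa> / real n \<and>
      (\<forall>x\<in>space ?P - E. \<forall>v. real n * (lambda_min (second_moment d \<nu>) / 2) * dot d v v
        \<le> (\<Sum>t=1..n. (dot d (x t) v)\<^sup>2))"
      unfolding C_def by blast
  qed
qed

section \<open>The noise event\<close>

lemma dot_design: "dot n \<eta> (design d n x w) = (\<Sum>t=1..n. \<eta> t * dot d (x t) w)"
  by (simp add: dot_def design_def)

lemma dot_design_design: "dot n (design d n x w) (design d n x w) = (\<Sum>t=1..n. (dot d (x t) w)\<^sup>2)"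
  by (simp add: dot_def design_def power2_eq_square)

lemma design_in_gen_space:
  assumes "w \<in> gen_space d r f"
  shows "design d n x w \<in> gen_space n r (\<lambda>j. design d n x (f j))"
  using assms unfolding design_gen_space[symmetric] by (rule imageI)

text \<open>Rounding applies the same function to every coordinate, so equal coordinates stay equal
  and the rational approximants remain in \<open>fixed_space\<close>.\<close>

lemma floor_approx_tendsto:
  fixes x :: real
  shows "(\<lambda>k. of_int \<lfloor>real (Suc k) * x\<rfloor> / real (Suc k)) \<longlonglongrightarrow> x"
proof (rule tendsto_sandwich[OF _ _ _ tendsto_const])
  have "(\<lambda>k. x - inverse (real (Suc k))) \<longlonglongrightarrow> x - 0"
    by (intro tendsto_diff tendsto_const LIMSEQ_inverse_real_of_nat)
  then show "(\<lambda>k. x - inverse (real (Suc k))) \<longlonglongrightarrow> x"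
    by simp
  show "\<forall>\<^sub>F k in sequentially. x - inverse (real (Suc k)) \<le> of_int \<lfloor>real (Suc k) * x\<rfloor> / real (Suc k)"
  proof (rule always_eventually, rule allI)
    fix k
    have "real (Suc k) * x - 1 \<le> of_int \<lfloor>real (Suc k) * x\<rfloor>"
      by linarith
    then have "(real (Suc k) * x - 1) / real (Suc k) \<le> of_int \<lfloor>real (Suc k) * x\<rfloor> / real (Suc k)"
      by (intro divide_right_mono) auto
    then show "x - inverse (real (Suc k)) \<le> of_int \<lfloor>real (Suc k) * x\<rfloor> / real (Suc k)"
      by (simp add: diff_divide_distrib inverse_eq_divide)
  qed
  show "\<forall>\<^sub>F k in sequentially. of_int \<lfloor>real (Suc k) * x\<rfloor> / real (Suc k) \<le> x"
  proof (rule always_eventually, rule allI)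
    fix k
    have "of_int \<lfloor>real (Suc k) * x\<rfloor> / real (Suc k) \<le> (real (Suc k) * x) / real (Suc k)"
      by (intro divide_right_mono of_int_floor_le) auto
    then show "of_int \<lfloor>real (Suc k) * x\<rfloor> / real (Suc k) \<le> x"
      by simp
  qed
qed

lemma countable_rational_vecs: "countable (PiE {1..d} (\<lambda>_. \<rat>) :: rvec set)"
  by (intro countable_PiE) (auto simp: countable_rat)

text \<open>
  The factor \<open>1/2\<close> is chosen so that \<open>u = th / 2\<close>, a vector of the selected model, yields
  \<open>\<langle>\<eta>, X \<delta>\<rangle> - |X \<delta>|\<^sup>2 / 4\<close> for \<open>\<delta> = th - \<theta>\<close>; at \<open>u = th\<close> the least squares inequality would give nothing.
\<close>

definition noise_excess :: "nat \<Rightarrow> nat \<Rightarrow> rvec \<Rightarrow> (nat \<Rightarrow> rvec) \<Rightarrow> rvec \<Rightarrow> rvec \<Rightarrow> real" where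
  "noise_excess d n \<theta> x \<eta> u =
     2 * dot n \<eta> (design d n x (\<lambda>i. u i - \<theta> i / 2))
       - dot n (design d n x (\<lambda>i. u i - \<theta> i / 2)) (design d n x (\<lambda>i. u i - \<theta> i / 2))"

text \<open>Rational vectors suffice; this is what makes the bad event of the noise measurable.\<close>

lemma noise_excess_le_of_rational:
  assumes u: "u \<in> fixed_space d p" and p: "partition_on {1..d} p"
    and le: "\<And>u. u \<in> fixed_space d p \<inter> PiE {1..d} (\<lambda>_. \<rat>) \<Longrightarrow> noise_excess d n \<theta> x \<eta> u \<le> s"
  shows "noise_excess d n \<theta> x \<eta> u \<le> s"
proof -
  define q where "q = (\<lambda>k. \<lambda>i\<in>{1..d}. of_int \<lfloor>real (Suc k) * u i\<rfloor> / real (Suc k) :: real)"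
  have "q k \<in> fixed_space d p" for k
    unfolding fixed_space_def
  proof (intro CollectI conjI ballI)
    show "q k \<in> vecs d"
      by (simp add: q_def)
    fix B i j assume B: "B \<in> p" "i \<in> B" "j \<in> B"
    then have "i \<in> {1..d}" "j \<in> {1..d}"
      using p unfolding partition_on_def by blast+
    moreover have "u i = u j"
      using u B unfolding fixed_space_def by blast
    ultimately show "q k i = q k j"
      by (simp add: q_def)
  qed
  moreover have "q k \<in> PiE {1..d} (\<lambda>_. \<rat>)" for k
    unfolding q_def by auto
  ultimately have q: "noise_excess d n \<theta> x \<eta> (q k) \<le> s" for k
    using le by blast
  have "(\<lambda>k. q k i) \<longlonglongrightarrow> u i" if "i \<in> {1..d}" for i
    unfolding q_def using floor_approx_tendsto[of "u i"] that by simp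
  then have "(\<lambda>k. noise_excess d n \<theta> x \<eta> (q k)) \<longlonglongrightarrow> noise_excess d n \<theta> x \<eta> u"
    unfolding noise_excess_def dot_design_design unfolding dot_design dot_def[of d]
    by (intro tendsto_intros) auto
  then show ?thesis
    using q by (intro LIMSEQ_le_const2) auto
qed

text \<open>Here the design \<open>x\<close> is fixed. The vector \<open>\<theta>\<close> joins the
  generators of the model, whence the exponent \<open>card p + 1\<close>; one event serves all
  \<open>u\<close> of the model.\<close>

lemma noise_excess_tail:
  assumes \<sigma>: "\<sigma> > 0" and n: "n \<le> T" and p: "partition_on {1..d} p" and \<theta>: "\<theta> \<in> vecs d"
  obtains A where "A \<in> sets (gauss_vec {1..T} \<sigma>)"
    and "emeasure (gauss_vec {1..T} \<sigma>) A \<le> ennreal (exp (- s / (4 * \<sigma>\<^sup>2)) * sqrt 2 ^ (card p + 1))"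
    and "\<And>\<eta> u. \<eta> \<in> space (gauss_vec {1..T} \<sigma>) - A \<Longrightarrow> u \<in> fixed_space d p
      \<Longrightarrow> noise_excess d n \<theta> x \<eta> u \<le> s"
proof -
  obtain f where f: "fixed_space d p = gen_space d (card p) f"
    using fixed_space_gen[OF p] .
  define h where "h = (\<lambda>j. design d n x (append_gens (card p) f (\<lambda>_. \<theta>) j))"
  obtain A where A: "A \<in> sets (gauss_vec {1..T} \<sigma>)"
    "emeasure (gauss_vec {1..T} \<sigma>) A \<le> ennreal (exp (- s / (4 * \<sigma>\<^sup>2)) * sqrt 2 ^ (card p + 1))"
    "\<And>\<eta> v. \<eta> \<in> space (gauss_vec {1..T} \<sigma>) - A \<Longrightarrow> v \<in> gen_space n (card p + 1) h
      \<Longrightarrow> 2 * dot n \<eta> v - dot n v v \<le> s"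
    using gauss_vec_gen_space_tail[OF \<sigma> n] by blast
  have mem: "design d n x (\<lambda>i. u i - \<theta> i / 2) \<in> gen_space n (card p + 1) h" if u: "u \<in> fixed_space d p" for u
  proof -
    have "\<theta> \<in> gen_space d 1 (\<lambda>_. \<theta>)"
      by (rule gen_spaceI[where a = "\<lambda>_. 1", OF \<theta>]) simp
    from gen_space_append[OF u[unfolded f] this, of 1 "- 1 / 2"]
    have "(\<lambda>i\<in>{1..d}. 1 * u i + (- 1 / 2) * \<theta> i) \<in> gen_space d (card p + 1) (append_gens (card p) f (\<lambda>_. \<theta>))" .
    then have "design d n x (\<lambda>i\<in>{1..d}. 1 * u i + (- 1 / 2) * \<theta> i) \<in> gen_space n (card p + 1) h"
      unfolding h_def by (rule design_in_gen_space)
    also have "design d n x (\<lambda>i\<in>{1..d}. 1 * u i + (- 1 / 2) * \<theta> i) = design d n x (\<lambda>i. u i - \<theta> i / 2)"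
      unfolding design_def by (intro restrict_ext dot_cong) auto
    finally show ?thesis .
  qed
  show ?thesis
    by (rule that[OF A(1,2)]) (unfold noise_excess_def, rule A(3)[OF _ mem])
qed

text \<open>Tonelli: a bound that holds conditionally on the first component holds jointly.\<close>

lemma emeasure_pair_le_section_bound:
  assumes "prob_space M1" "prob_space M2" and E: "E \<in> sets (M1 \<Otimes>\<^sub>M M2)"
    and le: "\<And>x. x \<in> space M1 \<Longrightarrow> emeasure M2 (Pair x -` E) \<le> c"
  shows "emeasure (M1 \<Otimes>\<^sub>M M2) E \<le> c"
proof -
  interpret M1: prob_space M1 by fact
  interpret M2: prob_space M2 by fact
  have "emeasure (M1 \<Otimes>\<^sub>M M2) E = (\<integral>\<^sup>+x. emeasure M2 (Pair x -` E) \<partial>M1)"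
    by (rule M2.emeasure_pair_measure_alt[OF E])
  also have "\<dots> \<le> (\<integral>\<^sup>+x. c \<partial>M1)"
    by (intro nn_integral_mono le)
  finally show ?thesis
    by (simp add: M1.emeasure_space_1)
qed

text \<open>The event from \<open>noise_excess_tail\<close> varies with the design, and nothing says
  that it does so measurably. The joint event is therefore built from the inequalities themselves at
  rational vectors. Its section at \<open>x\<close> is contained in
  \<open>A \<times> space U\<close>, with \<open>A\<close> the event of that design; the seed is
  independent of the noise and adds no probability.\<close>

lemma noise_event:
  assumes \<sigma>: "\<sigma> > 0" and n: "n \<le> T" and \<theta>: "\<theta> \<in> vecs d"
    and Q: "finite Q" "\<And>p. p \<in> Q \<Longrightarrow> partition_on {1..d} p \<and> card p \<le> d0"
    and \<nu>: "prob_space \<nu>" "sets \<nu> = sets (arm_space d X)" and U: "prob_space U"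
  defines "\<Omega> \<equiv> sample_space \<nu> \<sigma> n T U"
  obtains E where "E \<in> sets \<Omega>"
    and "emeasure \<Omega> E \<le> ennreal (real (card Q) * (exp (- s / (4 * \<sigma>\<^sup>2)) * sqrt 2 ^ (d0 + 1)))"
    and "\<And>x \<eta> u p v. (x, \<eta>, u) \<in> space \<Omega> - E \<Longrightarrow> p \<in> Q \<Longrightarrow> v \<in> fixed_space d p
      \<Longrightarrow> noise_excess d n \<theta> x \<eta> v \<le> s"
proof -
  let ?P = "Pi\<^sub>M {1..n} (\<lambda>_. \<nu>)" and ?N = "gauss_vec {1..T} \<sigma>"
  interpret N: prob_space ?N
    by (rule prob_space_gauss_vec[OF \<sigma>])
  interpret U: prob_space U by fact
  interpret NU: pair_prob_space ?N U ..
  have \<Omega>: "\<Omega> = ?P \<Otimes>\<^sub>M (?N \<Otimes>\<^sub>M U)"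
    by (simp add: \<Omega>_def sample_space_def)
  define D where "D = (\<lambda>p. fixed_space d p \<inter> PiE {1..d} (\<lambda>_. \<rat>))"
  have D: "countable (D p)" for p
    unfolding D_def by (rule countable_subset[OF _ countable_rational_vecs]) auto
  define c where "c = exp (- s / (4 * \<sigma>\<^sup>2)) * sqrt 2 ^ (d0 + 1)"
  define E where "E = (\<lambda>p. \<Union>v\<in>D p. {\<omega> \<in> space \<Omega>. s < noise_excess d n \<theta> (fst \<omega>) (fst (snd \<omega>)) v})"
  have x_meas: "(\<lambda>\<omega>. dot d (fst \<omega> t) w) \<in> borel_measurable \<Omega>" if "t \<in> {1..n}" for t w
  proof -
    have "(\<lambda>y. dot d y w) \<in> borel_measurable \<nu>"
      unfolding dot_def
      by (intro borel_measurable_sum borel_measurable_times borel_measurable_const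
          coord_measurable_arm_dist[OF \<nu>(2)])
    then have "(\<lambda>x. dot d (x t) w) \<in> borel_measurable ?P"
      by (rule measurable_compose[OF measurable_component_singleton[OF that]])
    then show ?thesis
      unfolding \<Omega> by (rule measurable_compose[OF measurable_fst])
  qed
  have \<eta>_meas: "(\<lambda>\<omega>. fst (snd \<omega>) t) \<in> borel_measurable \<Omega>" if "t \<in> {1..n}" for t
  proof -
    have "(\<lambda>\<eta>. \<eta> t) \<in> ?N \<rightarrow>\<^sub>M gauss \<sigma>"
      using that n by (intro measurable_component_singleton) auto
    then have "(\<lambda>\<eta>. \<eta> t) \<in> borel_measurable ?N"
      by (simp add: measurable_cong_sets[OF refl, of "gauss \<sigma>" borel])
    then show ?thesis
      unfolding \<Omega> by (intro measurable_compose[OF measurable_snd] measurable_compose[OF measurable_fst])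
  qed
  have "(\<lambda>\<omega>. noise_excess d n \<theta> (fst \<omega>) (fst (snd \<omega>)) v) \<in> borel_measurable \<Omega>" for v
    unfolding noise_excess_def dot_design_design unfolding dot_design
    by (intro borel_measurable_diff borel_measurable_times borel_measurable_sum borel_measurable_power
        borel_measurable_const x_meas \<eta>_meas)
  then have "{\<omega> \<in> space \<Omega>. s < noise_excess d n \<theta> (fst \<omega>) (fst (snd \<omega>)) v} \<in> sets \<Omega>" for v
    by measurable
  then have E: "E p \<in> sets \<Omega>" for p
    unfolding E_def using D by (intro sets.countable_UN') auto
  have E_le: "emeasure \<Omega> (E p) \<le> ennreal c" if p: "p \<in> Q" for p
    unfolding \<Omega>
  proof (rule emeasure_pair_le_section_bound)
    show "prob_space ?P" using \<nu>(1) by (intro prob_space_PiM)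
    show "prob_space (?N \<Otimes>\<^sub>M U)"
      by (rule NU.P.prob_space_axioms)
    show "E p \<in> sets (?P \<Otimes>\<^sub>M (?N \<Otimes>\<^sub>M U))" using E[of p] by (simp add: \<Omega>)
    fix x assume "x \<in> space ?P"
    obtain A where A: "A \<in> sets ?N"
      "emeasure ?N A \<le> ennreal (exp (- s / (4 * \<sigma>\<^sup>2)) * sqrt 2 ^ (card p + 1))"
      "\<And>\<eta> u. \<eta> \<in> space ?N - A \<Longrightarrow> u \<in> fixed_space d p \<Longrightarrow> noise_excess d n \<theta> x \<eta> u \<le> s"
      using noise_excess_tail[OF \<sigma> n _ \<theta>] Q(2)[OF p] by blast
    have "Pair x -` E p \<subseteq> A \<times> space U"
    proof
      fix y assume "y \<in> Pair x -` E p"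
      then obtain v where v: "v \<in> D p" and y: "(x, y) \<in> space \<Omega>" "s < noise_excess d n \<theta> x (fst y) v"
        by (auto simp: E_def)
      from y(1) have "fst y \<in> space ?N" "snd y \<in> space U"
        by (auto simp: \<Omega> space_pair_measure)
      moreover have "fst y \<in> A"
      proof (rule ccontr)
        assume "fst y \<notin> A"
        with A(3)[of "fst y" v] v y(2) \<open>fst y \<in> space ?N\<close> show False
          by (auto simp: D_def)
      qed
      ultimately show "y \<in> A \<times> space U"
        by (simp add: mem_Times_iff)
    qed
    then have "emeasure (?N \<Otimes>\<^sub>M U) (Pair x -` E p) \<le> emeasure (?N \<Otimes>\<^sub>M U) (A \<times> space U)"
      using A(1) by (intro emeasure_mono) auto
    also have "\<dots> = emeasure ?N A"
      using A(1) by (simp add: U.emeasure_pair_measure_Times U.emeasure_space_1)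
    also have "\<dots> \<le> ennreal (exp (- s / (4 * \<sigma>\<^sup>2)) * sqrt 2 ^ (card p + 1))"
      by (rule A(2))
    also have "\<dots> \<le> ennreal c"
      unfolding c_def using Q(2)[OF p] by (intro ennreal_leI mult_left_mono power_increasing) auto
    finally show "emeasure (?N \<Otimes>\<^sub>M U) (Pair x -` E p) \<le> ennreal c" .
  qed
  show ?thesis
  proof (rule that)
    show "(\<Union>p\<in>Q. E p) \<in> sets \<Omega>"
      using Q(1) E by (intro sets.finite_UN) auto
    have "emeasure \<Omega> (\<Union>p\<in>Q. E p) \<le> (\<Sum>p\<in>Q. emeasure \<Omega> (E p))"
      using Q(1) E by (intro emeasure_subadditive_finite) auto
    also have "\<dots> \<le> (\<Sum>p\<in>Q. ennreal c)"
      by (intro sum_mono E_le)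
    also have "\<dots> = ennreal (real (card Q) * c)"
      by (simp add: ennreal_mult ennreal_of_nat_eq_real_of_nat c_def)
    finally show "emeasure \<Omega> (\<Union>p\<in>Q. E p)
      \<le> ennreal (real (card Q) * (exp (- s / (4 * \<sigma>\<^sup>2)) * sqrt 2 ^ (d0 + 1)))"
      unfolding c_def .
    fix x \<eta> u p v
    assume \<omega>: "(x, \<eta>, u) \<in> space \<Omega> - (\<Union>p\<in>Q. E p)" and p: "p \<in> Q" and v: "v \<in> fixed_space d p"
    show "noise_excess d n \<theta> x \<eta> v \<le> s"
    proof (rule noise_excess_le_of_rational[OF v])
      show "partition_on {1..d} p" using Q(2)[OF p] by blast
      fix w assume "w \<in> fixed_space d p \<inter> PiE {1..d} (\<lambda>_. \<rat>)"
      moreover have "(x, \<eta>, u) \<notin> E p"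
        using \<omega> p by blast
      ultimately show "noise_excess d n \<theta> x \<eta> w \<le> s"
        using \<omega> unfolding E_def D_def by (auto simp: not_less)
    qed
  qed
qed

section \<open>Estimation error and regret\<close>

lemma proj_gen_space_mem: "proj n (gen_space n r f) v \<in> gen_space n r f"
proof -
  obtain k e where "orthonormal n k e" "gen_space n r f = gen_space n k e"
    by (rule gen_space_orthonormal)
  then show ?thesis
    by (simp only: proj_orthonormal(1)) (rule gen_spaceI[where a = "\<lambda>l. dot n v (e l)"], simp_all)
qed

lemma fixed_space_scale:
  assumes "u \<in> fixed_space d p" "partition_on {1..d} p"
  shows "(\<lambda>i\<in>{1..d}. c * u i) \<in> fixed_space d p"
  unfolding fixed_space_def
proof (intro CollectI conjI ballI)
  show "(\<lambda>i\<in>{1..d}. c * u i) \<in> vecs d"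
    by simp
  fix B i j assume B: "B \<in> p" "i \<in> B" "j \<in> B"
  then have "i \<in> {1..d}" "j \<in> {1..d}"
    using assms(2) unfolding partition_on_def by blast+
  moreover have "u i = u j"
    using assms(1) B unfolding fixed_space_def by blast
  ultimately show "(\<lambda>i\<in>{1..d}. c * u i) i = (\<lambda>i\<in>{1..d}. c * u i) j"
    by simp
qed

lemma selected_least_squares_le:
  assumes Q: "\<And>p. p \<in> Q \<Longrightarrow> partition_on {1..d} p"
    and mh: "is_arg_min (\<lambda>m. (vnorm n (\<lambda>t. Y t - proj n (design d n x ` m) Y t))\<^sup>2) (\<lambda>m. m \<in> models d Q) mh"
    and th: "is_arg_min (\<lambda>\<theta>. (vnorm n (\<lambda>t. Y t - design d n x \<theta> t))\<^sup>2) (\<lambda>\<theta>. \<theta> \<in> mh) th"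
    and \<theta>: "\<theta> \<in> fixed_space d q" "q \<in> Q"
  shows "(vnorm n (\<lambda>t. Y t - design d n x th t))\<^sup>2 \<le> (vnorm n (\<lambda>t. Y t - design d n x \<theta> t))\<^sup>2"
proof -
  obtain p where p: "p \<in> Q" "mh = fixed_space d p"
    using mh by (auto simp: is_arg_min_linorder models_def)
  obtain f where f: "fixed_space d p = gen_space d (card p) f"
    using fixed_space_gen[OF Q[OF p(1)]] .
  obtain g where g: "fixed_space d q = gen_space d (card q) g"
    using fixed_space_gen[OF Q[OF \<theta>(2)]] .
  \<comment> \<open>The projection is \<open>X w\<close> for some \<open>w\<close> in the selected
    model, so the residual of \<open>th\<close> does not exceed the one by which the model was
    selected.\<close>
  have "proj n (design d n x ` mh) Y \<in> design d n x ` mh"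
    unfolding p(2) f design_gen_space by (rule proj_gen_space_mem)
  then obtain w where w: "w \<in> mh" "proj n (design d n x ` mh) Y = design d n x w"
    by blast
  have "(vnorm n (\<lambda>t. Y t - design d n x th t))\<^sup>2 \<le> (vnorm n (\<lambda>t. Y t - design d n x w t))\<^sup>2"
    using th w(1) by (simp add: is_arg_min_linorder)
  also have "\<dots> \<le> (vnorm n (\<lambda>t. Y t - proj n (design d n x ` fixed_space d q) Y t))\<^sup>2"
    using mh \<theta>(2) by (simp add: is_arg_min_linorder models_def w(2))
  also have "\<dots> \<le> (vnorm n (\<lambda>t. Y t - design d n x \<theta> t))\<^sup>2"
    unfolding g design_gen_space
    using design_in_gen_space[OF \<theta>(1)[unfolded g]]
    by (intro power_mono proj_gen_space(2)) auto
  finally show ?thesis .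
qed

text \<open>Write \<open>a\<close> for \<open>X \<delta>\<close>. Least squares gives
  \<open>|a|\<^sup>2 \<le> 2 * dot n \<eta> a\<close>, and the noise bound at half of
  \<open>th\<close> gives \<open>dot n \<eta> a - |a|\<^sup>2 / 4 \<le> s\<close>. Together
  \<open>|a|\<^sup>2 \<le> 2 * s + |a|\<^sup>2 / 2\<close>, hence the factor 4.\<close>

lemma estimate_error:
  fixes x :: "nat \<Rightarrow> rvec" and \<theta> \<eta> :: rvec and n :: nat
  assumes Q: "\<And>p. p \<in> Q \<Longrightarrow> partition_on {1..d} p"
  defines "Y \<equiv> rewards d n \<theta> x \<eta>"
  assumes mh: "is_arg_min (\<lambda>m. (vnorm n (\<lambda>t. Y t - proj n (design d n x ` m) Y t))\<^sup>2) (\<lambda>m. m \<in> models d Q) mh"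
    and th: "is_arg_min (\<lambda>\<theta>. (vnorm n (\<lambda>t. Y t - design d n x \<theta> t))\<^sup>2) (\<lambda>\<theta>. \<theta> \<in> mh) th"
    and \<theta>: "\<theta> \<in> fixed_space d q" "q \<in> Q"
    and noise: "\<And>p v. p \<in> Q \<Longrightarrow> v \<in> fixed_space d p \<Longrightarrow> noise_excess d n \<theta> x \<eta> v \<le> s"
  shows "(\<Sum>t=1..n. (dot d (x t) (\<lambda>i. th i - \<theta> i))\<^sup>2) \<le> 4 * s"
proof -
  define a where "a = (\<lambda>t. dot d (x t) (\<lambda>i. th i - \<theta> i))"
  obtain p where p: "p \<in> Q" "th \<in> fixed_space d p"
    using mh th by (auto simp: is_arg_min_linorder models_def)
  have "(vnorm n (\<lambda>t. Y t - design d n x th t))\<^sup>2 = (\<Sum>t=1..n. (\<eta> t - a t)\<^sup>2)"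
    unfolding vnorm_power2 dot_def[of n]
    by (intro sum.cong) (auto simp: Y_def rewards_def design_def a_def dot_diff_right power2_eq_square algebra_simps)
  moreover have "(vnorm n (\<lambda>t. Y t - design d n x \<theta> t))\<^sup>2 = (\<Sum>t=1..n. (\<eta> t)\<^sup>2)"
    unfolding vnorm_power2 dot_def[of n]
    by (intro sum.cong) (auto simp: Y_def rewards_def design_def power2_eq_square)
  ultimately have "(\<Sum>t=1..n. (\<eta> t - a t)\<^sup>2) \<le> (\<Sum>t=1..n. (\<eta> t)\<^sup>2)"
    using selected_least_squares_le[OF Q mh th \<theta>] by simp
  moreover have "(\<Sum>t=1..n. (\<eta> t - a t)\<^sup>2) = (\<Sum>t=1..n. (\<eta> t)\<^sup>2) - 2 * (\<Sum>t=1..n. \<eta> t * a t) + (\<Sum>t=1..n. (a t)\<^sup>2)"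
    by (simp add: power2_diff sum.distrib sum_subtractf sum_distrib_left mult_ac)
  ultimately have basic: "(\<Sum>t=1..n. (a t)\<^sup>2) \<le> 2 * (\<Sum>t=1..n. \<eta> t * a t)"
    by linarith
  define v where "v = (\<lambda>i\<in>{1..d}. (1/2) * th i)"
  have va: "dot d (x t) (\<lambda>i. v i - \<theta> i / 2) = a t / 2" for t
  proof -
    have "dot d (x t) (\<lambda>i. v i - \<theta> i / 2) = dot d (x t) (\<lambda>i. (1/2) * (th i - \<theta> i))"
      by (intro dot_cong) (auto simp: v_def field_simps)
    then show ?thesis
      unfolding dot_scale_right by (simp add: a_def)
  qed
  have "noise_excess d n \<theta> x \<eta> v \<le> s"
    unfolding v_def by (intro noise[OF p(1)] fixed_space_scale p(2) Q[OF p(1)])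
  moreover have "noise_excess d n \<theta> x \<eta> v = (\<Sum>t=1..n. \<eta> t * a t) - (\<Sum>t=1..n. (a t)\<^sup>2) / 4"
    unfolding noise_excess_def dot_design_design unfolding dot_design va
    by (simp add: sum_distrib_left sum_divide_distrib power_divide)
  ultimately show ?thesis
    using basic unfolding a_def by linarith
qed

text \<open>As \<open>z\<close> is optimal for \<open>th\<close>, the gap is at most
  \<open>dot d z \<delta> - dot d xs \<delta>\<close>; the two terms give the factor 2. Since
  \<open>\<delta>\<close> lies in a joined model, each arm may be replaced by its projection before
  Cauchy-Schwarz, so that \<open>Kx\<close> appears in place of the length of the arm.\<close>

lemma commit_gap:
  assumes Q: "\<And>p. p \<in> Q \<Longrightarrow> partition_on {1..d} p"
    and th: "th \<in> fixed_space d p" "p \<in> Q" and \<theta>: "\<theta> \<in> fixed_space d q" "q \<in> Q"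
    and K: "\<And>y m. y \<in> X \<Longrightarrow> m \<in> joined_models d Q \<Longrightarrow> (vnorm d (proj d m y))\<^sup>2 \<le> Kx"
    and xs: "xs \<in> X" and z: "is_arg_max (\<lambda>z. dot d th z) (\<lambda>z. z \<in> X) z"
  defines "\<delta> \<equiv> \<lambda>i. th i - \<theta> i"
  shows "dot d (\<lambda>i. xs i - z i) \<theta> \<le> 2 * sqrt Kx * sqrt (dot d \<delta> \<delta>)"
proof -
  obtain f where f: "fixed_space d p = gen_space d (card p) f"
    using fixed_space_gen[OF Q[OF th(2)]] .
  obtain g where g: "fixed_space d q = gen_space d (card q) g"
    using fixed_space_gen[OF Q[OF \<theta>(2)]] .
  define S where "S = gen_space d (card p + card q) (append_gens (card p) f g)"
  have S: "S \<in> joined_models d Q"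
    unfolding joined_models_def S_def convex_hull_gen_space[symmetric] models_def
    using th(2) \<theta>(2) f g by blast
  have \<delta>S: "(\<lambda>i\<in>{1..d}. \<delta> i) \<in> S"
    using gen_space_append[OF th(1)[unfolded f] \<theta>(1)[unfolded g], of 1 "-1"]
    by (simp add: S_def \<delta>_def)
  have bound: "\<bar>dot d y \<delta>\<bar> \<le> sqrt Kx * sqrt (dot d \<delta> \<delta>)" if y: "y \<in> X" for y
  proof -
    have "dot d y \<delta> = dot d y (\<lambda>i\<in>{1..d}. \<delta> i)"
      by (intro dot_cong) auto
    also have "\<dots> = dot d (proj d S y) (\<lambda>i\<in>{1..d}. \<delta> i)"
      using proj_gen_space(1)[OF \<delta>S[unfolded S_def]] by (simp add: S_def)
    also have "\<dots> = dot d (proj d S y) \<delta>"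
      by (intro dot_cong) auto
    finally have "\<bar>dot d y \<delta>\<bar> \<le> vnorm d (proj d S y) * vnorm d \<delta>"
      using dot_le_vnorm[of d "proj d S y" \<delta>] by simp
    also have "vnorm d \<delta> = sqrt (dot d \<delta> \<delta>)"
      by (simp add: vnorm_power2[symmetric])
    also have "vnorm d (proj d S y) * sqrt (dot d \<delta> \<delta>) \<le> sqrt Kx * sqrt (dot d \<delta> \<delta>)"
      using real_le_rsqrt[OF K[OF y S]] by (intro mult_right_mono) auto
    finally show ?thesis .
  qed
  have zX: "z \<in> X" and "dot d th xs \<le> dot d th z"
    using z xs by (auto simp: is_arg_max_linorder)
  then have "dot d xs th \<le> dot d z th"
    by (simp add: dot_commute)
  moreover have "dot d y \<delta> = dot d y th - dot d y \<theta>" for y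
    unfolding \<delta>_def by (rule dot_diff_right)
  ultimately have "dot d (\<lambda>i. xs i - z i) \<theta> \<le> dot d z \<delta> - dot d xs \<delta>"
    by (simp add: dot_diff_left)
  with bound[OF zX] bound[OF xs] show ?thesis
    by linarith
qed

text \<open>A pointwise bound outside an exceptional event: \<open>2 * R\<close> per exploratory
  round and \<open>G\<close> per commit round. On the exceptional event all \<open>T\<close> rounds
  are charged \<open>2 * R\<close>. Being pointwise, the bound holds for every way of breaking
  ties.\<close>

lemma regret_bound:
  assumes X: "X \<subseteq> vecs d" and \<theta>: "\<theta> \<in> fixed_space d q" "q \<in> Q"
    and xs: "xs \<in> X" and \<sigma>: "\<sigma> > 0"
    and Q: "finite Q" "\<And>p. p \<in> Q \<Longrightarrow> partition_on {1..d} p \<and> card p \<le> d0"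
    and K: "\<And>y m. y \<in> X \<Longrightarrow> m \<in> joined_models d Q \<Longrightarrow> (vnorm d (proj d m y))\<^sup>2 \<le> Kx"
    and Kx: "Kx > 0"
    and R: "\<And>y. y \<in> X \<Longrightarrow> \<bar>dot d y \<theta>\<bar> \<le> R" and R0: "R > 0"
    and \<nu>: "prob_space \<nu>" "sets \<nu> = sets (arm_space d X)" and C: "C > 0"
    and E1: "E1 \<in> sets (Pi\<^sub>M {1..n} (\<lambda>_. \<nu>))" "measure (Pi\<^sub>M {1..n} (\<lambda>_. \<nu>)) E1 \<le> \<epsilon>"
      "\<And>x v. x \<in> space (Pi\<^sub>M {1..n} (\<lambda>_. \<nu>)) - E1 \<Longrightarrow>
        real n * (C / 2) * dot d v v \<le> (\<Sum>t=1..n. (dot d (x t) v)\<^sup>2)"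
    and n: "n \<ge> 1" "n \<le> T" and s: "s \<ge> 0" and U: "prob_space U"
    and run: "emc_run d X Q \<theta> n T (sample_space \<nu> \<sigma> n T U) mh th play"
  shows "regret d \<theta> xs T (sample_space \<nu> \<sigma> n T U) (emc_arm n play)
    \<le> 2 * R * real n + real T * (2 * sqrt Kx * sqrt (8 * s / (real n * C)))
      + 2 * R * real T * (\<epsilon> + real (card Q) * (exp (- s / (4 * \<sigma>\<^sup>2)) * sqrt 2 ^ (d0 + 1)))"
proof -
  define \<Omega> where "\<Omega> = sample_space \<nu> \<sigma> n T U"
  let ?P = "Pi\<^sub>M {1..n} (\<lambda>_. \<nu>)" and ?N = "gauss_vec {1..T} \<sigma>"
  interpret N: prob_space ?N
    by (rule prob_space_gauss_vec[OF \<sigma>])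
  interpret U: prob_space U by fact
  interpret NU: pair_prob_space ?N U ..
  interpret P: prob_space ?P
    using \<nu>(1) by (intro prob_space_PiM)
  interpret PNU: pair_prob_space ?P "?N \<Otimes>\<^sub>M U" ..
  have \<Omega>: "\<Omega> = ?P \<Otimes>\<^sub>M (?N \<Otimes>\<^sub>M U)"
    by (simp add: \<Omega>_def sample_space_def)
  interpret O: prob_space \<Omega>
    unfolding \<Omega> by (rule PNU.P.prob_space_axioms)
  have \<theta>v: "\<theta> \<in> vecs d"
    using \<theta>(1) by (simp add: fixed_space_def)
  have part: "\<And>p. p \<in> Q \<Longrightarrow> partition_on {1..d} p"
    using Q(2) by blast
  define c where "c = real (card Q) * (exp (- s / (4 * \<sigma>\<^sup>2)) * sqrt 2 ^ (d0 + 1))"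
  obtain E2 where E2: "E2 \<in> sets \<Omega>" "emeasure \<Omega> E2 \<le> ennreal c"
    "\<And>x \<eta> u p v. (x, \<eta>, u) \<in> space \<Omega> - E2 \<Longrightarrow> p \<in> Q \<Longrightarrow> v \<in> fixed_space d p
      \<Longrightarrow> noise_excess d n \<theta> x \<eta> v \<le> s"
    unfolding \<Omega>_def c_def using noise_event[OF \<sigma> n(2) \<theta>v Q \<nu> U] by blast
  define B where "B = E1 \<times> space (?N \<Otimes>\<^sub>M U) \<union> E2"
  have B: "B \<in> sets \<Omega>"
    unfolding B_def using E1(1) E2(1) by (auto simp: \<Omega>)
  have mB: "measure \<Omega> B \<le> \<epsilon> + c"
  proof -
    have "measure \<Omega> (E1 \<times> space (?N \<Otimes>\<^sub>M U)) = measure ?P E1"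
      unfolding \<Omega> measure_def NU.P.emeasure_pair_measure_Times[OF E1(1) sets.top] NU.P.emeasure_space_1
      by simp
    moreover have "measure \<Omega> E2 \<le> c"
      unfolding measure_def using E2(2) by (intro enn2real_leI) (auto simp: c_def)
    moreover have "measure \<Omega> B \<le> measure \<Omega> (E1 \<times> space (?N \<Otimes>\<^sub>M U)) + measure \<Omega> E2"
      unfolding B_def using E1(1) E2(1) by (intro measure_Un_le) (auto simp: \<Omega>)
    ultimately show ?thesis
      using E1(2) by linarith
  qed
  define G where "G = 2 * sqrt Kx * sqrt (8 * s / (real n * C))"
  have G: "G \<ge> 0"
    unfolding G_def using Kx s C n by simp
  define f where "f = (\<lambda>\<omega>. \<Sum>t=1..T. dot d (\<lambda>i. xs i - emc_arm n play t \<omega> i) \<theta>)"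
  have armX: "emc_arm n play t \<omega> \<in> X" if \<omega>: "\<omega> \<in> space \<Omega>" and t: "t \<in> {1..T}" for \<omega> t
  proof -
    obtain x \<eta> u where eq: "\<omega> = (x, \<eta>, u)"
      using prod_cases3 by blast
    show ?thesis
    proof (cases "t \<le> n")
      case True
      have "x \<in> space ?P"
        using \<omega> by (simp add: \<Omega> eq space_pair_measure)
      then have "x t \<in> space \<nu>"
        using True t by (auto simp: space_PiM)
      then show ?thesis
        using True by (simp add: emc_arm_def eq space_arm_dist[OF X \<nu>(2)])
    next
      case False
      then have "is_arg_max (\<lambda>z. dot d (th \<omega>) z) (\<lambda>z. z \<in> X) (play t \<omega>)"
        using run \<omega> t unfolding emc_run_def \<Omega>_def[symmetric] Let_def eq by auto
      then show ?thesis
        using False by (simp add: emc_arm_def is_arg_max_linorder)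
    qed
  qed
  have gap: "dot d (\<lambda>i. xs i - y i) \<theta> \<le> 2 * R" if "y \<in> X" for y
    using R[OF that] R[OF xs] unfolding dot_diff_left by linarith
  have f_le: "f \<omega> \<le> (2 * R * real n + real T * G) + 2 * R * real T * indicator B \<omega>"
    if \<omega>: "\<omega> \<in> space \<Omega>" for \<omega>
  proof (cases "\<omega> \<in> B")
    case True
    have "f \<omega> \<le> (\<Sum>t=1..T. 2 * R)"
      unfolding f_def using \<omega> by (intro sum_mono gap armX)
    also have "\<dots> \<le> (2 * R * real n + real T * G) + 2 * R * real T"
      using R0 G by simp
    finally show ?thesis
      using True by simp
  next
    case False
    obtain x \<eta> u where eq: "\<omega> = (x, \<eta>, u)"
      using prod_cases3 by blast
    let ?Y = "rewards d n \<theta> x \<eta>"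
    let ?\<delta> = "\<lambda>i. th \<omega> i - \<theta> i"
    have 1: "is_arg_min (\<lambda>m. (vnorm n (\<lambda>t. ?Y t - proj n (design d n x ` m) ?Y t))\<^sup>2) (\<lambda>m. m \<in> models d Q) (mh \<omega>)"
      and 2: "is_arg_min (\<lambda>\<theta>. (vnorm n (\<lambda>t. ?Y t - design d n x \<theta> t))\<^sup>2) (\<lambda>\<theta>. \<theta> \<in> mh \<omega>) (th \<omega>)"
      and 3: "\<And>t. t \<in> {n<..T} \<Longrightarrow> is_arg_max (\<lambda>z. dot d (th \<omega>) z) (\<lambda>z. z \<in> X) (play t \<omega>)"
      using run \<omega> unfolding emc_run_def \<Omega>_def[symmetric] Let_def eq by auto
    have "\<omega> \<in> space \<Omega> - E2"
      using \<omega> False by (auto simp: B_def)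
    then have "noise_excess d n \<theta> x \<eta> v \<le> s" if "p \<in> Q" "v \<in> fixed_space d p" for p v
      using E2(3) that unfolding eq by blast
    from estimate_error[OF part 1 2 \<theta> this]
    have err: "(\<Sum>t=1..n. (dot d (x t) ?\<delta>)\<^sup>2) \<le> 4 * s" .
    have "x \<in> space ?P - E1"
      using \<omega> False by (auto simp: B_def \<Omega> eq space_pair_measure)
    from E1(3)[OF this, of ?\<delta>] err have "real n * (C / 2) * dot d ?\<delta> ?\<delta> \<le> 4 * s"
      by linarith
    \<comment> \<open>The 8 is the 4 of \<open>estimate_error\<close> divided by the factor
      \<open>1/2\<close> lost on the eigenvalue.\<close>
    then have \<delta>: "dot d ?\<delta> ?\<delta> \<le> 8 * s / (real n * C)"
      using n C by (simp add: field_simps)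
    obtain p where p: "p \<in> Q" "th \<omega> \<in> fixed_space d p"
      using 1 2 by (auto simp: is_arg_min_linorder models_def)
    have commit: "dot d (\<lambda>i. xs i - play t \<omega> i) \<theta> \<le> G" if t: "t \<in> {n<..T}" for t
    proof -
      have "dot d (\<lambda>i. xs i - play t \<omega> i) \<theta> \<le> 2 * sqrt Kx * sqrt (dot d ?\<delta> ?\<delta>)"
        by (rule commit_gap[OF part p(2,1) \<theta> K xs 3[OF t]])
      also have "\<dots> \<le> G"
        unfolding G_def using \<delta> Kx by (intro mult_left_mono real_sqrt_le_mono) auto
      finally show ?thesis .
    qed
    have "f \<omega> \<le> (\<Sum>t=1..T. if t \<le> n then 2 * R else G)"
      unfolding f_def
    proof (rule sum_mono)
      fix t assume t: "t \<in> {1..T}"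
      show "dot d (\<lambda>i. xs i - emc_arm n play t \<omega> i) \<theta> \<le> (if t \<le> n then 2 * R else G)"
        using gap[OF armX[OF \<omega> t]] commit[of t] t by (auto simp: emc_arm_def)
    qed
    also have "\<dots> = (\<Sum>t=1..n. 2 * R) + (\<Sum>t=Suc n..T. G)"
    proof -
      have "{1..T} = {1..n} \<union> {Suc n..T}"
        using n by auto
      then show ?thesis
        by (simp add: sum.union_disjoint)
    qed
    also have "\<dots> \<le> 2 * R * real n + real T * G"
      using G n by (simp add: mult_right_mono)
    finally show ?thesis
      using False by simp
  qed
  have "(\<integral>\<omega>. f \<omega> \<partial>\<Omega>) \<le> (2 * R * real n + real T * G) + 2 * R * real T * (\<epsilon> + c)"
  proof (cases "integrable \<Omega> f")
    case True
    have ind: "integrable \<Omega> (\<lambda>\<omega>. indicator B \<omega> :: real)"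
      by (rule integrable_real_indicator[OF B]) (simp add: O.emeasure_eq_measure)
    have "(\<integral>\<omega>. f \<omega> \<partial>\<Omega>) \<le> (\<integral>\<omega>. (2 * R * real n + real T * G) + 2 * R * real T * indicator B \<omega> \<partial>\<Omega>)"
      using ind True f_le by (intro integral_mono) auto
    also have "\<dots> = (2 * R * real n + real T * G) + 2 * R * real T * measure \<Omega> B"
      using ind B by (subst Bochner_Integration.integral_add) (auto simp: O.prob_space)
    also have "\<dots> \<le> (2 * R * real n + real T * G) + 2 * R * real T * (\<epsilon> + c)"
      using mB R0 by (intro add_left_mono mult_left_mono) auto
    finally show ?thesis .
  next
    case False
    \<comment> \<open>A function that is not integrable has Bochner integral 0, so a nonnegative
      right-hand side settles this case.\<close>
    have "0 \<le> \<epsilon> + c"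
      using mB measure_nonneg[of \<Omega> B] by linarith
    then show ?thesis
      using False R0 G by (simp add: not_integrable_integral_eq)
  qed
  then show ?thesis
    unfolding regret_def f_def \<Omega>_def G_def c_def .
qed

section \<open>Choice of the exploration length\<close>

lemma theta_in_fixed_space_orbits:
  assumes G: "subgroup G (sym_group d)" and \<theta>: "\<theta> \<in> vecs d" "\<forall>g\<in>G. perm_act d g \<theta> = \<theta>"
  shows "\<theta> \<in> fixed_space d (orbit_partition d G)"
proof -
  have eq: "\<theta> (g i) = \<theta> i" if "g \<in> G" "i \<in> {1..d}" for g i
  proof -
    have "perm_act d g \<theta> i = \<theta> i"
      using \<theta>(2) that(1) by simp
    then show ?thesis
      using that(2) by (simp add: perm_act_def)
  qed
  have "\<theta> i = \<theta> j" if B: "B \<in> orbit_partition d G" "i \<in> B" "j \<in> B" for B i j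
  proof -
    obtain y where y: "y \<in> {1..d}" "B = {g y | g. g \<in> G}"
      using B(1) unfolding orbit_partition_def orbits_def orbit_def by auto
    then obtain g h where "g \<in> G" "i = g y" "h \<in> G" "j = h y"
      using B(2,3) by auto
    then show ?thesis
      using eq y(1) by simp
  qed
  then show ?thesis
    unfolding fixed_space_def using \<theta>(1) by (intro CollectI conjI ballI)
qed

lemma finite_partitions_upto: "finite (partitions_upto d d0)"
proof (rule finite_subset)
  show "partitions_upto d d0 \<subseteq> Pow (Pow {1..d})"
    unfolding partitions_upto_def partition_on_def by auto
qed simp

lemma card_partition_pos:
  fixes d :: nat
  assumes "partition_on {1..d} p" "d \<ge> 1"
  shows "card p \<ge> 1"
proof -
  have "finite p"
    by (rule finite_elements[OF finite_atLeastAtMost assms(1)])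
  moreover have "p \<noteq> {}"
    using assms by (auto simp: partition_on_def)
  ultimately show ?thesis
    using card_gt_0_iff[of p] by linarith
qed

text \<open>As \<open>d \<ge> 1\<close>, no partition has zero classes and \<open>k\<close> runs
  over \<open>{1..d0}\<close>. Each count is replaced by the largest bound, the one at
  \<open>k = d0\<close>, which costs a factor \<open>d0\<close>.\<close>

lemma card_models_le:
  fixes c C0 :: real
  assumes c: "c > 0" and C0: "C0 > 0" and d: "d \<ge> 1" and Q: "Q \<subseteq> partitions_upto d d0"
    and le: "\<forall>k\<in>{1..d0}. real (card {p \<in> Q. card p = k}) \<le> C0 * real d powr (c * real k)"
  shows "real (card Q) \<le> real d0 * C0 * real d powr (c * real d0)"
proof -
  have "card p \<in> {1..d0}" if p: "p \<in> Q" for p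
  proof -
    have "partition_on {1..d} p" "card p \<le> d0"
      using Q p by (auto simp: partitions_upto_def)
    then show ?thesis
      using card_partition_pos[OF _ d] by auto
  qed
  then have eq: "(\<Union>k\<in>{1..d0}. {p \<in> Q. card p = k}) = Q"
    by blast
  have "card (\<Union>k\<in>{1..d0}. {p \<in> Q. card p = k}) \<le> (\<Sum>k=1..d0. card {p \<in> Q. card p = k})"
    by (rule card_UN_le) simp
  then have "real (card Q) \<le> real (\<Sum>k=1..d0. card {p \<in> Q. card p = k})"
    unfolding eq by (rule of_nat_mono)
  also have "\<dots> = (\<Sum>k=1..d0. real (card {p \<in> Q. card p = k}))"
    by (rule of_nat_sum)
  also have "\<dots> \<le> (\<Sum>k=1..d0. C0 * real d powr (c * real d0))"
  proof (rule sum_mono)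
    fix k assume k: "k \<in> {1..d0}"
    then have "real (card {p \<in> Q. card p = k}) \<le> C0 * real d powr (c * real k)"
      using le by blast
    also have "\<dots> \<le> C0 * real d powr (c * real d0)"
      using k c C0 d by (intro mult_left_mono powr_mono) auto
    finally show "real (card {p \<in> Q. card p = k}) \<le> C0 * real d powr (c * real d0)" .
  qed
  finally show ?thesis
    by (simp add: mult.assoc)
qed

text \<open>With \<open>M = d0 * L\<close>, the factors \<open>d0\<close> and
  \<open>sqrt 2 ^ (d0 + 1)\<close> are at most \<open>exp M\<close> each, \<open>C0\<close> is at
  most \<open>exp (C0 * M)\<close> and the power of \<open>d\<close> at most
  \<open>exp (c * M)\<close>. One unit of the 3 in \<open>c + C0 + 3\<close> is left over and gives
  \<open>exp (- M) \<le> exp (- L) = 1 / (d * T)\<close>.\<close>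

lemma union_bound_le:
  fixes c C0 L N :: real
  assumes c: "c > 0" and C0: "C0 > 0" and d: "d \<ge> (1::nat)" and T: "T \<ge> (1::nat)" and d0: "d0 \<ge> (1::nat)"
    and L: "L = ln (real d * real T)" "L \<ge> 1"
    and N: "N \<le> real d0 * C0 * real d powr (c * real d0)"
  shows "N * (exp (- (real d0 * L * (c + C0 + 3))) * sqrt 2 ^ (d0 + 1)) \<le> 1 / real T"
proof -
  define M where "M = real d0 * L"
  have M': "M \<ge> real d0" "M \<ge> L"
    unfolding M_def using d0 L(2) mult_left_mono[of 1 L "real d0"] mult_right_mono[of 1 "real d0" L]
    by auto
  moreover from M'(2) L(2) have "M \<ge> 1"
    by linarith
  ultimately have M: "M \<ge> real d0" "M \<ge> L" "M \<ge> 1" .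
  have e1: "real d0 \<le> exp M"
    using exp_ge_add_one_self[of M] M by linarith
  have e2: "C0 \<le> exp (C0 * M)"
  proof -
    have "C0 \<le> C0 * M" using C0 M by simp
    then show ?thesis using exp_ge_add_one_self[of "C0 * M"] by linarith
  qed
  have e3: "real d powr (c * real d0) \<le> exp (c * M)"
  proof -
    have "ln (real d) \<le> L"
      unfolding L(1) using d T by (subst ln_le_cancel_iff) auto
    then have "c * real d0 * ln (real d) \<le> c * real d0 * L"
      using c by (intro mult_left_mono) auto
    then show ?thesis
      using d by (simp add: powr_def M_def mult.assoc)
  qed
  have e4: "sqrt 2 ^ (d0 + 1) \<le> exp M"
  proof -
    have "sqrt 2 ^ (d0 + 1) \<le> sqrt 2 ^ (2 * d0)"
      using d0 by (intro power_increasing) auto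
    also have "\<dots> = 2 ^ d0"
      by (simp add: power_mult)
    also have "\<dots> \<le> exp 1 ^ d0"
      using exp_ge_add_one_self[of 1] by (intro power_mono) auto
    also have "\<dots> = exp (real d0)"
      by (simp add: exp_of_nat_mult[symmetric])
    also have "\<dots> \<le> exp M"
      using M by simp
    finally show ?thesis .
  qed
  have "N * (exp (- (M * (c + C0 + 3))) * sqrt 2 ^ (d0 + 1))
      \<le> (exp M * exp (C0 * M) * exp (c * M)) * (exp (- (M * (c + C0 + 3))) * exp M)"
  proof (rule mult_mono)
    have "real d0 * C0 * real d powr (c * real d0) \<le> exp M * exp (C0 * M) * exp (c * M)"
      using C0 by (intro mult_mono e1 e2 e3) auto
    with N show "N \<le> exp M * exp (C0 * M) * exp (c * M)" by linarith
  qed (use e4 in auto)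
  also have "\<dots> = exp (- M)"
    by (simp add: exp_add[symmetric] algebra_simps)
  also have "\<dots> \<le> exp (- L)"
    using M by simp
  also have "\<dots> = 1 / (real d * real T)"
    using d T by (simp add: L(1) exp_minus inverse_eq_divide)
  also have "\<dots> \<le> 1 / real T"
    using d T by (intro divide_left_mono) auto
  finally show ?thesis
    by (simp add: M_def)
qed

text \<open>Collects the demands on \<open>T\<close>. The exploration length has order
  \<open>T\<close> to the power 2/3 up to a logarithm: it ends before \<open>T\<close>, while its
  square outgrows every multiple of \<open>T\<close>, which absorbs \<kappa>. The threshold may
  depend on \<open>a\<close>, \<open>d\<close> and \<kappa>.\<close>

lemma exploration_eventually:
  fixes a \<kappa> :: real and d :: nat
  assumes a: "a > 0" and d: "d \<ge> 1"
  shows "\<forall>\<^sub>F T in sequentially. ln (real d * real T) \<ge> 1 \<and> T \<ge> 1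
    \<and> a * real T powr (2/3) * ln (real d * real T) powr (1/3) \<ge> 1
    \<and> a * real T powr (2/3) * ln (real d * real T) powr (1/3) + 1 \<le> real T
    \<and> real T * \<kappa> \<le> (a * real T powr (2/3) * ln (real d * real T) powr (1/3))\<^sup>2"
proof -
  have d': "real d > 0" using d by simp
  show ?thesis
    using a d' by (intro eventually_conj eventually_ge_at_top; real_asymp)
qed

text \<open>The first identity is the balance equation behind the exploration length: it says that
  \<open>R * A\<close> equals \<open>T * sqrt (Kx * \<sigma>\<^sup>2 * D * L / (A * C))\<close>, the
  costs of exploring and of committing up to constants. The second recognises this common value as
  the claimed rate.\<close>

lemma exploration_cube:
  fixes R \<sigma> C Kx D T L :: real
  assumes "R > 0" "\<sigma> > 0" "C > 0" "Kx > 0" "D > 0" "T > 0" "L > 0"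
  defines "A \<equiv> R powr (-2/3) * \<sigma> powr (2/3) * C powr (-1/3) * Kx powr (1/3) * D powr (1/3)
    * T powr (2/3) * L powr (1/3)"
  shows "R\<^sup>2 * A ^ 3 = T\<^sup>2 * Kx * \<sigma>\<^sup>2 * D * L / C"
    and "R * A = R powr (1/3) * \<sigma> powr (2/3) * C powr (-1/3) * Kx powr (1/3) * D powr (1/3)
      * T powr (2/3) * L powr (1/3)"
proof -
  have cube: "(x powr b) ^ 3 = x powr (3 * b)" if "x > 0" for x b :: real
    using that by (simp add: powr_power mult.commute)
  have "A ^ 3 = R powr (-2) * \<sigma> powr 2 * C powr (-1) * Kx * D * T powr 2 * L"
    using assms(1-7) unfolding A_def power_mult_distrib by (simp add: cube)
  also have "\<dots> = R powr (-2) * (\<sigma>\<^sup>2 * Kx * D * T\<^sup>2 * L / C)"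
    using assms(1-7) by (simp add: powr_minus_divide)
  finally have "A ^ 3 = \<sigma>\<^sup>2 * Kx * D * T\<^sup>2 * L / C / R\<^sup>2"
    using assms(1) by (simp add: powr_minus_divide)
  then show "R\<^sup>2 * A ^ 3 = T\<^sup>2 * Kx * \<sigma>\<^sup>2 * D * L / C"
    using assms(1) by simp
  have "R * R powr (-2/3) = R powr (1/3)"
    using assms(1) powr_mult_base[of R "-2/3"] by simp
  then show "R * A = R powr (1/3) * \<sigma> powr (2/3) * C powr (-1/3) * Kx powr (1/3) * D powr (1/3)
      * T powr (2/3) * L powr (1/3)"
    unfolding A_def by (simp only: mult.assoc[symmetric])
qed

text \<open>In units of \<open>R * A\<close>, exploration contributes 4 because
  \<open>n \<le> 2 * A\<close>, and the two exceptional events contribute 2 each because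
  \<open>T * \<kappa> / n \<le> A\<close> and \<open>1 \<le> A\<close>. The commit rounds give the
  square root, where 32 is the 8 of the error bound times the 4 of the noise level.\<close>

lemma balance:
  fixes R \<sigma> C Kx D T L A n \<kappa> \<kappa>0 :: real
  assumes pos: "R > 0" "\<sigma> > 0" "C > 0" "Kx > 0" "D > 0" "T > 0" "L > 0" "\<kappa>0 > 0" "\<kappa> > 0"
    and A: "R\<^sup>2 * A ^ 3 = T\<^sup>2 * Kx * \<sigma>\<^sup>2 * D * L / C" "A \<ge> 1" "T * \<kappa> \<le> A\<^sup>2"
    and n: "n \<ge> A" "n \<le> A + 1"
  shows "2 * R * n + T * (2 * sqrt Kx * sqrt (8 * (4 * \<sigma>\<^sup>2 * (D * L * \<kappa>0)) / (n * C)))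
      + 2 * R * T * (\<kappa> / n + 1 / T) \<le> (8 + 2 * sqrt (32 * \<kappa>0)) * (R * A)"
proof -
  have "2 * R * n \<le> 2 * R * (2 * A)"
    using n A(2) pos by (intro mult_left_mono) auto
  moreover have "T * (2 * sqrt Kx * sqrt (8 * (4 * \<sigma>\<^sup>2 * (D * L * \<kappa>0)) / (n * C)))
      \<le> 2 * sqrt (32 * \<kappa>0) * (R * A)"
  proof -
    have "sqrt Kx * sqrt (8 * (4 * \<sigma>\<^sup>2 * (D * L * \<kappa>0)) / (n * C))
        \<le> sqrt Kx * sqrt (8 * (4 * \<sigma>\<^sup>2 * (D * L * \<kappa>0)) / (A * C))"
      using n A(2) pos by (intro mult_left_mono real_sqrt_le_mono divide_left_mono mult_right_mono) auto
    then have "T * (sqrt Kx * sqrt (8 * (4 * \<sigma>\<^sup>2 * (D * L * \<kappa>0)) / (n * C)))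
        \<le> T * (sqrt Kx * sqrt (8 * (4 * \<sigma>\<^sup>2 * (D * L * \<kappa>0)) / (A * C)))"
      using pos by (intro mult_left_mono) auto
    also have "\<dots> = sqrt (T\<^sup>2 * (Kx * (8 * (4 * \<sigma>\<^sup>2 * (D * L * \<kappa>0)) / (A * C))))"
      by (simp only: real_sqrt_mult real_sqrt_abs abs_of_pos[OF \<open>T > 0\<close>])
    also have "T\<^sup>2 * (Kx * (8 * (4 * \<sigma>\<^sup>2 * (D * L * \<kappa>0)) / (A * C)))
        = 32 * \<kappa>0 * ((T\<^sup>2 * Kx * \<sigma>\<^sup>2 * D * L / C) / A)"
      by (simp add: mult_ac)
    also have "\<dots> = 32 * \<kappa>0 * (R * A)\<^sup>2"
      unfolding A(1)[symmetric] using A(2) by (simp add: power2_eq_square power3_eq_cube)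
    also have "sqrt \<dots> = sqrt (32 * \<kappa>0) * (R * A)"
      using pos A(2) by (simp add: real_sqrt_mult)
    finally show ?thesis by simp
  qed
  moreover have "2 * R * T * (\<kappa> / n + 1 / T) \<le> 4 * (R * A)"
  proof -
    have "T * \<kappa> / n \<le> A\<^sup>2 / A"
      using n A pos by (intro frac_le) auto
    also have "\<dots> = A"
      using A(2) by (simp add: power2_eq_square)
    finally have "T * (\<kappa> / n + 1 / T) \<le> 2 * A"
      using A(2) pos by (simp add: distrib_left)
    then have "2 * R * (T * (\<kappa> / n + 1 / T)) \<le> 2 * R * (2 * A)"
      using pos by (intro mult_left_mono) auto
    then show ?thesis by simp
  qed
  ultimately have "2 * R * n + T * (2 * sqrt Kx * sqrt (8 * (4 * \<sigma>\<^sup>2 * (D * L * \<kappa>0)) / (n * C)))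
      + 2 * R * T * (\<kappa> / n + 1 / T) \<le> 2 * R * (2 * A) + 2 * sqrt (32 * \<kappa>0) * (R * A) + 4 * (R * A)"
    by (intro add_mono)
  also have "\<dots> = (8 + 2 * sqrt (32 * \<kappa>0)) * (R * A)"
    by (simp add: distrib_right)
  finally show ?thesis .
qed

theorem theorem1:
  fixes c C0 :: real
  assumes "c > 0" and "C0 > 0"
  shows "\<exists>K>0. \<forall>(d::nat) (d0::nat) (X::rvec set) (\<theta>\<^sub>s::rvec) (x\<^sub>s::rvec) (\<sigma>::real)
      (G::(nat \<Rightarrow> nat) set) (Q::nat set set set) (Kx::real) (Rmax::real) (\<nu>::rvec measure).
    d \<ge> 2 \<longrightarrow>
    X \<subseteq> vecs d \<longrightarrow>
    \<theta>\<^sub>s \<in> vecs d \<longrightarrow>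
    (\<forall>\<theta>\<in>vecs d. \<exists>x. is_arg_max (\<lambda>x. dot d x \<theta>) (\<lambda>x. x \<in> X) x) \<longrightarrow>
    is_arg_max (\<lambda>x. dot d x \<theta>\<^sub>s) (\<lambda>x. x \<in> X) x\<^sub>s \<longrightarrow>
    \<sigma> > 0 \<longrightarrow>
    subgroup G (sym_group d) \<longrightarrow>
    (\<forall>g\<in>G. perm_act d g \<theta>\<^sub>s = \<theta>\<^sub>s) \<longrightarrow>
    Q \<subseteq> partitions_upto d d0 \<longrightarrow>
    orbit_partition d G \<in> Q \<longrightarrow>
    (\<forall>k\<in>{1..d0}. real (card {p \<in> Q. card p = k}) \<le> C0 * real d powr (c * real k)) \<longrightarrow>
    Kx > 0 \<longrightarrow>
    Rmax > 0 \<longrightarrow>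
    (\<forall>x\<in>X. \<forall>m\<in>joined_models d Q. (vnorm d (proj d m x))\<^sup>2 \<le> Kx \<and> \<bar>dot d x \<theta>\<^sub>s\<bar> \<le> Rmax) \<longrightarrow>
    exploratory d X \<nu> \<longrightarrow>
    lambda_min (second_moment d \<nu>) > 0 \<longrightarrow>
    (\<forall>\<^sub>F T in sequentially. \<forall>(U::real measure) mh th play.
       let Cmin = lambda_min (second_moment d \<nu>);
           t1 = exploration_length Rmax \<sigma> Cmin Kx d0 d T;
           \<Omega> = sample_space \<nu> \<sigma> t1 T U
       in prob_space U \<longrightarrow>
          emc_run d X Q \<theta>\<^sub>s t1 T \<Omega> mh th play \<longrightarrow>
          regret d \<theta>\<^sub>s x\<^sub>s T \<Omega> (emc_arm t1 play)
            \<le> K * (Rmax powr (1/3) * \<sigma> powr (2/3) * Cmin powr (-1/3) * Kx powr (1/3)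
                 * real d0 powr (1/3) * real T powr (2/3) * ln (real d * real T) powr (1/3)))"
proof -
  \<comment> \<open>Only \<open>c\<close> and \<open>C0\<close> enter, so \<open>K\<close> is fixed
    before the dimension and all other parameters.\<close>
  define \<kappa>0 where "\<kappa>0 = c + C0 + 3"
  define K where "K = 8 + 2 * sqrt (32 * \<kappa>0)"
  have \<kappa>0: "\<kappa>0 > 0"
    using assms by (simp add: \<kappa>0_def)
  then have "K > 0"
    by (simp add: K_def add_pos_nonneg)
  show ?thesis
  proof (intro exI[of _ K] conjI \<open>K > 0\<close> allI impI)
    fix d d0 :: nat and X :: "rvec set" and \<theta>\<^sub>s x\<^sub>s :: rvec and \<sigma> :: real
      and G :: "(nat \<Rightarrow> nat) set" and Q :: "nat set set set" and Kx Rmax :: real and \<nu> :: "rvec measure"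
    assume d2: "d \<ge> 2" and X: "X \<subseteq> vecs d" and \<theta>: "\<theta>\<^sub>s \<in> vecs d"
      and attained: "\<forall>\<theta>\<in>vecs d. \<exists>x. is_arg_max (\<lambda>x. dot d x \<theta>) (\<lambda>x. x \<in> X) x"
      and xs: "is_arg_max (\<lambda>x. dot d x \<theta>\<^sub>s) (\<lambda>x. x \<in> X) x\<^sub>s"
      and \<sigma>: "\<sigma> > 0" and G: "subgroup G (sym_group d)" and inv: "\<forall>g\<in>G. perm_act d g \<theta>\<^sub>s = \<theta>\<^sub>s"
      and Q: "Q \<subseteq> partitions_upto d d0" and q: "orbit_partition d G \<in> Q"
      and cardQ: "\<forall>k\<in>{1..d0}. real (card {p \<in> Q. card p = k}) \<le> C0 * real d powr (c * real k)"
      and Kx: "Kx > 0" and R: "Rmax > 0"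
      and A2: "\<forall>x\<in>X. \<forall>m\<in>joined_models d Q. (vnorm d (proj d m x))\<^sup>2 \<le> Kx \<and> \<bar>dot d x \<theta>\<^sub>s\<bar> \<le> Rmax"
      and expl: "exploratory d X \<nu>" and C: "lambda_min (second_moment d \<nu>) > 0"
    define C where "C = lambda_min (second_moment d \<nu>)"
    have C_pos: "C > 0"
      using C by (simp add: C_def)
    have d: "d \<ge> 1"
      using d2 by simp
    have part: "partition_on {1..d} p \<and> card p \<le> d0" if "p \<in> Q" for p
      using Q that by (auto simp: partitions_upto_def)
    have finQ: "finite Q"
      by (rule finite_subset[OF Q finite_partitions_upto])
    have d0: "d0 \<ge> 1"
      using card_partition_pos[OF _ d] part[OF q] by (meson order_trans)
    have \<theta>q: "\<theta>\<^sub>s \<in> fixed_space d (orbit_partition d G)"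
      by (rule theta_in_fixed_space_orbits[OF G \<theta> inv])
    have \<nu>: "prob_space \<nu>" "sets \<nu> = sets (arm_space d X)"
      using expl by (auto simp: exploratory_def is_arg_max_linorder arm_dists_def)
    have xsX: "x\<^sub>s \<in> X"
      using xs by (simp add: is_arg_max_linorder)
    \<comment> \<open>In (A2) the reward bound stands under the quantifier over joined models, so it
      can be extracted once one of them is exhibited.\<close>
    have joined: "joined_models d Q \<noteq> {}"
      using q by (auto simp: joined_models_def models_def)
    have K_le: "(vnorm d (proj d m y))\<^sup>2 \<le> Kx" if "y \<in> X" "m \<in> joined_models d Q" for y m
      using A2 that by blast
    have R_le: "\<bar>dot d y \<theta>\<^sub>s\<bar> \<le> Rmax" if "y \<in> X" for y
      using A2 that joined by blast
    obtain b where b: "b > 0" "\<And>x i. x \<in> X \<Longrightarrow> i \<in> {1..d} \<Longrightarrow> \<bar>x i\<bar> \<le> b"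
      using arms_bounded[OF attained] by blast
    \<comment> \<open>Chosen before \<open>T\<close>, so that the threshold on \<open>T\<close> may
      depend on it.\<close>
    obtain \<kappa> where \<kappa>: "\<kappa> > 0" "\<And>n. n \<ge> 1 \<Longrightarrow> \<exists>E\<in>sets (Pi\<^sub>M {1..n} (\<lambda>_. \<nu>)).
      measure (Pi\<^sub>M {1..n} (\<lambda>_. \<nu>)) E \<le> \<kappa> / real n \<and>
      (\<forall>x\<in>space (Pi\<^sub>M {1..n} (\<lambda>_. \<nu>)) - E. \<forall>v.
        real n * (C / 2) * dot d v v \<le> (\<Sum>t=1..n. (dot d (x t) v)\<^sup>2))"
      unfolding C_def
      by (rule design_lower_bound[where d = d and X = X and \<nu> = \<nu> and b = b, OF d X \<nu> b(1) _ C])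
        (use b(2) in blast)+
    define a where "a = Rmax powr (-2/3) * \<sigma> powr (2/3) * C powr (-1/3) * Kx powr (1/3) * real d0 powr (1/3)"
    have a: "a > 0"
      using R \<sigma> C_pos Kx d0 by (simp add: a_def)
    show "\<forall>\<^sub>F T in sequentially. \<forall>(U::real measure) mh th play.
       let Cmin = lambda_min (second_moment d \<nu>);
           t1 = exploration_length Rmax \<sigma> Cmin Kx d0 d T;
           \<Omega> = sample_space \<nu> \<sigma> t1 T U
       in prob_space U \<longrightarrow>
          emc_run d X Q \<theta>\<^sub>s t1 T \<Omega> mh th play \<longrightarrow>
          regret d \<theta>\<^sub>s x\<^sub>s T \<Omega> (emc_arm t1 play)
            \<le> K * (Rmax powr (1/3) * \<sigma> powr (2/3) * Cmin powr (-1/3) * Kx powr (1/3)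
                 * real d0 powr (1/3) * real T powr (2/3) * ln (real d * real T) powr (1/3))"
      using exploration_eventually[OF a d, of \<kappa>]
    proof (rule eventually_mono, unfold Let_def C_def[symmetric], intro allI impI)
      fix T :: nat and U :: "real measure" and mh th play
      define L where "L = ln (real d * real T)"
      define A where "A = a * real T powr (2/3) * L powr (1/3)"
      define n where "n = exploration_length Rmax \<sigma> C Kx d0 d T"
      assume T: "ln (real d * real T) \<ge> 1 \<and> T \<ge> 1
        \<and> a * real T powr (2/3) * ln (real d * real T) powr (1/3) \<ge> 1
        \<and> a * real T powr (2/3) * ln (real d * real T) powr (1/3) + 1 \<le> real T
        \<and> real T * \<kappa> \<le> (a * real T powr (2/3) * ln (real d * real T) powr (1/3))\<^sup>2"
        and U: "prob_space U"
        and run: "emc_run d X Q \<theta>\<^sub>s (exploration_length Rmax \<sigma> C Kx d0 d T) T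
          (sample_space \<nu> \<sigma> (exploration_length Rmax \<sigma> C Kx d0 d T) T U) mh th play"
      have L: "L \<ge> 1" and T1: "T \<ge> 1" and A: "A \<ge> 1" "A + 1 \<le> real T" "real T * \<kappa> \<le> A\<^sup>2"
        using T by (simp_all add: L_def A_def)
      have n_eq: "n = nat \<lceil>A\<rceil>"
        by (simp only: n_def exploration_length_def A_def a_def L_def)
      have n_ge: "real n \<ge> A" and n_le: "real n \<le> A + 1"
        using A(1) unfolding n_eq by linarith+
      have n: "n \<ge> 1" "n \<le> T"
        using n_ge n_le A by linarith+
      obtain E1 where E1: "E1 \<in> sets (Pi\<^sub>M {1..n} (\<lambda>_. \<nu>))"
        "measure (Pi\<^sub>M {1..n} (\<lambda>_. \<nu>)) E1 \<le> \<kappa> / real n"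
        "\<And>x v. x \<in> space (Pi\<^sub>M {1..n} (\<lambda>_. \<nu>)) - E1 \<Longrightarrow>
          real n * (C / 2) * dot d v v \<le> (\<Sum>t=1..n. (dot d (x t) v)\<^sup>2)"
        using \<kappa>(2)[OF n(1)] by blast
      \<comment> \<open>The level at which the tail exponent
        \<open>s / (4 * \<sigma>\<^sup>2)\<close> equals \<open>d0 * L * \<kappa>0\<close>, the
        amount that \<open>union_bound_le\<close> can spend.\<close>
      define s where "s = 4 * \<sigma>\<^sup>2 * (real d0 * L * \<kappa>0)"
      have s: "s \<ge> 0"
        using L \<kappa>0 by (simp add: s_def)
      have ub: "real (card Q) * (exp (- s / (4 * \<sigma>\<^sup>2)) * sqrt 2 ^ (d0 + 1)) \<le> 1 / real T"
      proof -
        have "- s / (4 * \<sigma>\<^sup>2) = - (real d0 * L * (c + C0 + 3))"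
          using \<sigma> by (simp add: s_def \<kappa>0_def)
        then show ?thesis
          using union_bound_le[OF assms d T1 d0 L_def L card_models_le[OF assms d Q cardQ]] by simp
      qed
      have "regret d \<theta>\<^sub>s x\<^sub>s T (sample_space \<nu> \<sigma> n T U) (emc_arm n play)
          \<le> 2 * Rmax * real n + real T * (2 * sqrt Kx * sqrt (8 * s / (real n * C)))
            + 2 * Rmax * real T
              * (\<kappa> / real n + real (card Q) * (exp (- s / (4 * \<sigma>\<^sup>2)) * sqrt 2 ^ (d0 + 1)))"
        by (rule regret_bound[where X = X and q = "orbit_partition d G" and C = C and ?E1.0 = E1,
              OF X \<theta>q q xsX \<sigma> finQ _ _ Kx _ R \<nu> C_pos E1(1,2) _ n s U run[folded n_def]])
          (use part K_le R_le E1(3) in blast)+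
      also have "\<dots> \<le> 2 * Rmax * real n + real T * (2 * sqrt Kx * sqrt (8 * s / (real n * C)))
            + 2 * Rmax * real T * (\<kappa> / real n + 1 / real T)"
        using R ub by (intro add_left_mono mult_left_mono) auto
      also have "\<dots> \<le> K * (Rmax * A)"
      proof -
        have "Rmax\<^sup>2 * A ^ 3 = (real T)\<^sup>2 * Kx * \<sigma>\<^sup>2 * real d0 * L / C"
          unfolding A_def a_def using R \<sigma> C_pos Kx d0 T1 L by (intro exploration_cube(1)) auto
        from balance[OF R \<sigma> C_pos Kx _ _ _ \<kappa>0 \<kappa>(1) this A(1,3) n_ge n_le] show ?thesis
          unfolding K_def s_def using d0 T1 L by simp
      qed
      also have "Rmax * A = Rmax powr (1/3) * \<sigma> powr (2/3) * C powr (-1/3) * Kx powr (1/3)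
          * real d0 powr (1/3) * real T powr (2/3) * L powr (1/3)"
        unfolding A_def a_def using R \<sigma> C_pos Kx d0 T1 L by (intro exploration_cube(2)) auto
      finally show "regret d \<theta>\<^sub>s x\<^sub>s T (sample_space \<nu> \<sigma> (exploration_length Rmax \<sigma> C Kx d0 d T) T U)
          (emc_arm (exploration_length Rmax \<sigma> C Kx d0 d T) play)
        \<le> K * (Rmax powr (1/3) * \<sigma> powr (2/3) * C powr (-1/3) * Kx powr (1/3)
               * real d0 powr (1/3) * real T powr (2/3) * ln (real d * real T) powr (1/3))"
        unfolding n_def L_def .
    qed
  qed
qed

end
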